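(* Let $n\ge3$ and $1\le k\le n$ be integers, let $f:[0,\infty)\to(0,\infty)$ and $g:(-\infty,0]\to(0,\infty)$ be continuous with $f(r+T_f)=f(r)$ for all $r\ge0$ and $g(t-T_g)=g(t)$ for all $t\le0$, where $T_f,T_g>0$. Let $\alpha=1$ and let $u(x,t)=w(t)v(|x|)$ be the constructed separable solution of $-u_t\,\sigma_k(\lambda(D^2u))=f(|x|)g(t)$ in $\mathbb{R}^n\times(-\infty,0]$ (defined in the context). Then there exist $T_f$-periodic functions $F_1,F_2$ whose integrals over a period are zero such that, as $r\to\infty$, $$v(r)=C r^{\frac{2k}{k+1}}+r^{-\frac{2}{k+1}}F_1(r)+r^{-\frac{k+3}{k+1}}F_2(r)+O\bigl(r^{-M_{n,k}}\bigr),$$ where $$C=\Bigl(\frac{k+1}{2k}\Bigr)^{\frac{k}{k+1}}\Bigl(\frac{n\bar f}{C_n^k\,(n-\frac{2k}{k+1})}\Bigr)^{\frac1{k+1}},\qquad \bar f=\frac1{T_f}\int_0^{T_f}f(\tau)\,d\tau,$$ and $$M_{n,k}=\min\Bigl\{-\frac{2k\lambda_*}{k+1},\ \frac{2}{k+1}\Bigr\},$$ with $\lambda_*$ the larger of the real parts of the two numbers $$\lambda_\pm=-\frac{(n-4)k+n}{4k}\pm\frac1{4k}\sqrt{((n-4)k+n)^2-8((n-2)k+n)}.$$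
   Context: $\sigma_k$ is the $k$-th elementary symmetric function, $\lambda(D^2u)$ the eigenvalues of the Hessian of $u$ in $x$, and $C_n^k=\binom{n}{k}$. In the case $\alpha=1$, the constructed separable solution is $u(x,t)=w(t)v(|x|)$, where $$w(t)=(k+1)^{\frac1{k+1}}\Bigl(1+\int_t^0 g(s)\,ds\Bigr)^{\frac1{k+1}},\quad t\le0,$$ and $v\in C^2([0,\infty))$, $v>0$, is the unique solution of $$v'(r)=\Bigl(\frac{n r^{k-n}}{C_n^k}\int_0^r s^{n-1}\frac{f(s)}{v(s)}\,ds\Bigr)^{1/k}\ (r>0),\qquad v(0)=1.$$ *)

theory Defs
  imports "HOL-Analysis.Analysis" "HOL-Library.Landau_Symbols"
begin

definition C2_on :: "real set \<Rightarrow> (real \<Rightarrow> real) \<Rightarrow> bool" where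
  "C2_on S h \<longleftrightarrow> (\<exists>h1 h2.
     (\<forall>r\<in>S. (h has_real_derivative h1 r) (at r within S)) \<and>
     (\<forall>r\<in>S. (h1 has_real_derivative h2 r) (at r within S)) \<and>
     continuous_on S h2)"

definition elem_sym :: "nat \<Rightarrow> ('n::finite \<Rightarrow> real) \<Rightarrow> real" where
  "elem_sym k l = (\<Sum>S | S \<subseteq> UNIV \<and> card S = k. \<Prod>i\<in>S. l i)"

text \<open>The family \<open>l\<close> lists the eigenvalues of \<open>A\<close> with algebraic multiplicity: it is
  determined up to a permutation of the indices, which \<^const>\<open>elem_sym\<close> does not see.\<close>
definition eigenvalues :: "real^'n^'n \<Rightarrow> ('n::finite \<Rightarrow> real) \<Rightarrow> bool" where
  "eigenvalues A l \<longleftrightarrow> (\<forall>s. det (mat s - A) = (\<Prod>i\<in>UNIV. s - l i))"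

definition has_hessian :: "(real^'n \<Rightarrow> real) \<Rightarrow> real^'n^'n \<Rightarrow> real^'n::finite \<Rightarrow> bool" where
  "has_hessian h A x \<longleftrightarrow> (\<exists>G. (\<forall>y. (h has_derivative (\<lambda>z. G y \<bullet> z)) (at y)) \<and>
     (G has_derivative (\<lambda>z. A *v z)) (at x))"

text \<open>Classical solutions of \<open>- u\<^sub>t \<sigma>\<^sub>k(\<lambda>(D\<^sup>2u)) = f(|x|) g(t)\<close> for \<open>t \<le> 0\<close>;
  at \<open>t = 0\<close> the time derivative is one-sided.\<close>
definition solves_hessian_equation ::
  "nat \<Rightarrow> (real \<Rightarrow> real) \<Rightarrow> (real \<Rightarrow> real) \<Rightarrow> (real^'n::finite \<Rightarrow> real \<Rightarrow> real) \<Rightarrow> bool" where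
  "solves_hessian_equation k f g u \<longleftrightarrow> (\<forall>x. \<forall>t\<le>0. \<exists>ut A l.
     (u x has_real_derivative ut) (at t within {..0}) \<and>
     has_hessian (\<lambda>y. u y t) A x \<and> eigenvalues A l \<and>
     - ut * elem_sym k l = f (norm x) * g t)"

definition time_factor :: "nat \<Rightarrow> (real \<Rightarrow> real) \<Rightarrow> real \<Rightarrow> real" where
  "time_factor k g t =
     (real k + 1) powr (1 / (real k + 1)) * (1 + integral {t..0} g) powr (1 / (real k + 1))"

text \<open>The exponent \<open>k - n\<close> may be negative, hence \<^const>\<open>powr\<close>.\<close>
definition radial_profile :: "nat \<Rightarrow> nat \<Rightarrow> (real \<Rightarrow> real) \<Rightarrow> (real \<Rightarrow> real) \<Rightarrow> bool" where
  "radial_profile n k f v \<longleftrightarrow>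
     C2_on {0..} v \<and> (\<forall>r\<ge>0. v r > 0) \<and> v 0 = 1 \<and>
     (\<forall>r>0. (v has_real_derivative
        (real n * r powr (real k - real n) / real (n choose k)
          * integral {0..r} (\<lambda>s. s ^ (n - 1) * (f s / v s))) powr (1 / real k)) (at r))"

definition period_mean :: "real \<Rightarrow> (real \<Rightarrow> real) \<Rightarrow> real" where
  "period_mean T f = 1 / T * integral {0..T} f"

definition zero_mean_periodic :: "real \<Rightarrow> (real \<Rightarrow> real) \<Rightarrow> bool" where
  "zero_mean_periodic T F \<longleftrightarrow>
     (\<forall>r. F (r + T) = F r) \<and> F absolutely_integrable_on {0..T} \<and> integral {0..T} F = 0"

definition leading_coeff :: "nat \<Rightarrow> nat \<Rightarrow> real \<Rightarrow> real" where
  "leading_coeff n k m =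
     ((real k + 1) / (2 * real k)) powr (real k / (real k + 1)) *
     (real n * m / (real (n choose k) * (real n - 2 * real k / (real k + 1))))
       powr (1 / (real k + 1))"

definition discriminant :: "nat \<Rightarrow> nat \<Rightarrow> real" where
  "discriminant n k =
     ((real n - 4) * real k + real n)\<^sup>2 - 8 * ((real n - 2) * real k + real n)"

definition lambda_plus :: "nat \<Rightarrow> nat \<Rightarrow> complex" where
  "lambda_plus n k =
     of_real (- ((real n - 4) * real k + real n) / (4 * real k))
     + of_real (1 / (4 * real k)) * csqrt (of_real (discriminant n k))"

definition lambda_minus :: "nat \<Rightarrow> nat \<Rightarrow> complex" where
  "lambda_minus n k =
     of_real (- ((real n - 4) * real k + real n) / (4 * real k))
     - of_real (1 / (4 * real k)) * csqrt (of_real (discriminant n k))"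

definition lambda_star :: "nat \<Rightarrow> nat \<Rightarrow> real" where
  "lambda_star n k = max (Re (lambda_plus n k)) (Re (lambda_minus n k))"

definition remainder_exponent :: "nat \<Rightarrow> nat \<Rightarrow> real" where
  "remainder_exponent n k =
     min (- (2 * real k * lambda_star n k / (real k + 1))) (2 / (real k + 1))"

end

theory Submission
  imports Defs "HOL-Real_Asymp.Real_Asymp"
begin

text \<open>Write \<open>\<beta> = 2k/(k+1)\<close>, \<open>\<gamma> = n - \<beta>\<close>, \<open>\<phi> = f / mean f\<close> and \<open>t = ln r\<close>. With
\<open>p(t) = v(r) / (C r\<^sup>\<beta>)\<close> and \<open>q\<close> the correspondingly scaled integral \<open>\<integral>\<^sub>0\<^sup>r s\<^sup>n\<^sup>-\<^sup>1 f/v ds\<close>, the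
equation for \<open>v\<close> becomes the planar system
  \<open>p' = \<beta> (q\<^sup>1\<^sup>/\<^sup>k - p)\<close>,  \<open>q' = \<gamma> (\<phi>(e\<^sup>t)/p - q)\<close>,
whose averaged version (\<open>\<phi> = 1\<close>) has the equilibrium \<open>(1,1)\<close>. Everything comes down to the
rate at which \<open>p\<close> tends to \<open>1\<close>: it is \<open>p - 1 = O(e\<^sup>-\<^sup>\<mu>\<^sup>t)\<close> with \<open>\<mu> = 2\<close> for \<open>n \<ge> 4\<close> and
\<open>\<mu> = 3/2\<close> for \<open>n = 3\<close> (\<open>sharp_decay\<close>), that is \<open>v(r) = C r\<^sup>\<beta> + O(r\<^sup>\<beta>\<^sup>-\<^sup>\<mu>)\<close>. The exponent \<open>\<beta> - \<mu>\<close> is at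
most \<open>-M\<close> (\<open>remainder_exponent_le\<close>). Since \<open>M \<le> 2/(k+1)\<close>, bounded
oscillating terms of orders \<open>-2/(k+1)\<close> and \<open>-(k+3)/(k+1)\<close> are themselves of the size
of the remainder, so the expansion holds with \<open>F\<^sub>1 = F\<^sub>2 = 0\<close>.

The rate is obtained in three steps.

A priori bounds (\<open>a_priori_bounds\<close>). In the variables \<open>P = p\<^sup>1\<^sup>+\<^sup>1\<^sup>/\<^sup>k\<close> and \<open>Z = p q\<close> the system is
\<open>P' = 2 (Z\<^sup>1\<^sup>/\<^sup>k - P)\<close>, \<open>Z' = \<gamma> \<phi> - n Z + \<beta> Z\<^sup>1\<^sup>+\<^sup>1\<^sup>/\<^sup>k / P\<close>. Linear comparison bounds first \<open>Z\<close> and \<open>P\<close>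
from below, then \<open>q\<close> and \<open>p\<close> from above, and finally \<open>q = Z/p\<close> from below.

Convergence at some exponential rate (\<open>exponential_convergence\<close>). The averaged system is a negative
feedback loop and has the Lyapunov function
\<open>V = \<gamma> (p - ln p - 1) + \<beta> \<integral>\<^sub>1\<^sup>q (x\<^sup>1\<^sup>/\<^sup>k - 1) dx\<close>, because the cross terms of the two equations cancel.
The forcing \<open>\<phi>(e\<^sup>t) - 1\<close> is not small, but it oscillates with frequency \<open>e\<^sup>t\<close>: with a periodic
primitive \<open>H\<close> of \<open>\<phi> - 1\<close>, the function \<open>A = e\<^sup>-\<^sup>t H(e\<^sup>t)\<close> satisfies \<open>A' = -A + (\<phi>(e\<^sup>t) - 1)\<close>, and
subtracting a multiple of \<open>A\<close> from \<open>V\<close> turns the forcing into a perturbation of size \<open>e\<^sup>-\<^sup>t\<close>.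

The sharp rate (\<open>sharp_decay\<close>). The linearisation at \<open>(1,1)\<close> has trace \<open>-n\<close> and determinant
\<open>2 (n - \<beta>)\<close>. In suitable coordinates it reads \<open>x' = -\<mu> x + s\<close>, \<open>s' = -\<kappa> x - (n-\<mu>) s\<close> with
\<open>\<kappa> > 0\<close> and \<open>n - \<mu> \<ge> \<mu>\<close>, so that \<open>e\<^sup>2\<^sup>\<mu>\<^sup>t (\<kappa> x\<^sup>2 + s\<^sup>2)\<close> is nonincreasing along its solutions,
whatever the nature of the eigenvalues. For \<open>n = 4\<close> the eigenvalues have real part exactly \<open>-2\<close>, so a forcing merely
known to be \<open>O(e\<^sup>-\<^sup>2\<^sup>t)\<close> could produce a logarithm. Hence all forcing terms down to that order
are computed: they are multiples of \<open>A\<close> and \<open>A\<^sup>2\<close>, and an explicit corrector of size \<open>e\<^sup>-\<^sup>2\<^sup>t\<close>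
removes them. What is left is integrable against the energy (\<open>perturbed_oscillator_decay\<close>).\<close>

section \<open>Periodic functions and their primitives\<close>

lemma integral_from_zero:
  fixes h :: "real \<Rightarrow> real"
  assumes cont: "continuous_on {0..} h"
  shows "continuous_on {0..} (\<lambda>r. integral {0..r} h)"
    and "r > 0 \<Longrightarrow> ((\<lambda>r. integral {0..r} h) has_real_derivative h r) (at r)"
proof -
  have dI: "((\<lambda>r. integral {0..r} h) has_real_derivative h r) (at r within {0..b})" if "0 \<le> r" "r \<le> b" for r b
    using that by (intro integral_has_real_derivative continuous_on_subset[OF cont]) auto
  show "continuous_on {0..} (\<lambda>r. integral {0..r} h)"
    unfolding continuous_on_eq_continuous_within
  proof
    fix r :: real assume r: "r \<in> {0..}"
    have "at r within {0..} = at r within {0..r+1}"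
      by (rule at_within_nhd[of _ "{..<r+1}"]) auto
    then show "continuous (at r within {0..}) (\<lambda>r. integral {0..r} h)"
      using dI[of r "r + 1"] r by (auto intro: DERIV_continuous)
  qed
  show "((\<lambda>r. integral {0..r} h) has_real_derivative h r) (at r)" if "r > 0"
  proof -
    have "at r within {0..r+1} = at r" by (rule at_within_interior) (use that in auto)
    then show ?thesis using dI[of r "r+1"] that by simp
  qed
qed

lemma integral_from_zero_pos:
  fixes h :: "real \<Rightarrow> real"
  assumes cont: "continuous_on {0..} h" and pos: "\<And>s. s > 0 \<Longrightarrow> h s > 0" and "r > 0"
  shows "integral {0..r} h > 0"
proof -
  have "integral {0..0} h < integral {0..r} h"
  proof (rule DERIV_pos_imp_increasing_open[OF \<open>r > 0\<close>])
    show "\<exists>y. ((\<lambda>r. integral {0..r} h) has_real_derivative y) (at x) \<and> 0 < y" if "0 < x" "x < r" for x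
      using integral_from_zero(2)[OF cont that(1)] pos[OF that(1)] by blast
    show "continuous_on {0..r} (\<lambda>r. integral {0..r} h)"
      using integral_from_zero(1)[OF cont] by (rule continuous_on_subset) auto
  qed
  then show ?thesis by simp
qed

definition zero_mean_on_period :: "real \<Rightarrow> (real \<Rightarrow> real) \<Rightarrow> bool" where
  "zero_mean_on_period T h \<longleftrightarrow> continuous_on {0..} h \<and> (\<forall>r\<ge>0. h (r + T) = h r) \<and> integral {0..T} h = 0"

lemma periodic_reduce:
  fixes h :: "real \<Rightarrow> real"
  assumes "T > 0" and per: "\<forall>r\<ge>0. h (r + T) = h r" and "r \<ge> 0"
  obtains s where "0 \<le> s" "s \<le> T" "h r = h s"
proof -
  have shift: "h (s + real j * T) = h s" if "s \<ge> 0" for s j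
  proof (induction j)
    case (Suc j)
    have "h (s + real (Suc j) * T) = h ((s + real j * T) + T)" by (simp add: algebra_simps)
    also have "\<dots> = h (s + real j * T)" using per that assms(1) by simp
    finally show ?case using Suc by simp
  qed simp
  define j where "j = nat \<lfloor>r / T\<rfloor>"
  have j: "real j = of_int \<lfloor>r / T\<rfloor>" using assms by (simp add: j_def)
  have "real j * T \<le> r" "r < (real j + 1) * T"
    using floor_divide_lower[OF assms(1), of r] floor_divide_upper[OF assms(1), of r] j by auto
  then have "0 \<le> r - real j * T" "r - real j * T \<le> T" by (auto simp: algebra_simps)
  moreover have "h r = h (r - real j * T)" using shift[of "r - real j * T" j] calculation by simp
  ultimately show ?thesis using that by blast
qed

lemma periodic_attains_bounds:
  fixes h :: "real \<Rightarrow> real"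
  assumes "T > 0" and "continuous_on {0..} h" and per: "\<forall>r\<ge>0. h (r + T) = h r"
  obtains a b where "0 \<le> a" "0 \<le> b" "\<forall>r\<ge>0. h a \<le> h r \<and> h r \<le> h b"
proof -
  have c: "continuous_on {0..T} h" using assms(2) continuous_on_subset by fastforce
  obtain a where a: "a \<in> {0..T}" "\<forall>y\<in>{0..T}. h a \<le> h y"
    using continuous_attains_inf[OF compact_Icc _ c] assms(1) by force
  obtain b where b: "b \<in> {0..T}" "\<forall>y\<in>{0..T}. h y \<le> h b"
    using continuous_attains_sup[OF compact_Icc _ c] assms(1) by force
  show ?thesis
  proof (rule that[of a b])
    show "\<forall>r\<ge>0. h a \<le> h r \<and> h r \<le> h b"
    proof (intro allI impI)
      fix r :: real assume "r \<ge> 0"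
      then obtain s where "0 \<le> s" "s \<le> T" "h r = h s" using periodic_reduce assms by metis
      then show "h a \<le> h r \<and> h r \<le> h b" using a b by auto
    qed
  qed (use a b in auto)
qed

lemma zero_mean_on_period_bounded:
  assumes "T > 0" "zero_mean_on_period T h"
  obtains B where "\<forall>r\<ge>0. \<bar>h r\<bar> \<le> B"
proof -
  obtain a b where "\<forall>r\<ge>0. h a \<le> h r \<and> h r \<le> h b"
    using periodic_attains_bounds assms unfolding zero_mean_on_period_def by metis
  then have "\<forall>r\<ge>0. \<bar>h r\<bar> \<le> max \<bar>h a\<bar> \<bar>h b\<bar>" by force
  then show ?thesis using that by blast
qed

text \<open>The primitive from \<open>0\<close> is periodic because the integral over a period vanishes; subtracting its
mean makes it zero-mean again, so that the construction can be iterated.\<close>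
lemma zero_mean_on_period_primitive:
  assumes T: "T > 0" and h: "zero_mean_on_period T h"
  obtains H where "zero_mean_on_period T H"
    "\<forall>r>0. (H has_real_derivative h r) (at r)"
proof -
  have cont: "continuous_on {0..} h" and per: "\<forall>r\<ge>0. h (r + T) = h r"
    and int0: "integral {0..T} h = 0" using h by (auto simp: zero_mean_on_period_def)
  define I where "I r = integral {0..r} h" for r
  have contI0: "continuous_on {0..} I" and derI: "\<And>r. r > 0 \<Longrightarrow> (I has_real_derivative h r) (at r)"
    unfolding I_def using integral_from_zero[OF cont] by blast+
  have contIb: "continuous_on {0..b} I" for b
    using contI0 by (rule continuous_on_subset) auto
  have perI: "I (r + T) = I r" if "r \<ge> 0" for r
  proof -
    define D where "D s = I (s + T) - I s" for s
    have "D r = D 0"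
    proof (cases "r = 0")
      case False
      have "continuous_on {0..r} (\<lambda>s. I (s + T))"
        using contI0 T by (auto intro!: continuous_on_compose2[of "{0..}" I] continuous_intros)
      then have c: "continuous_on {0..r} D" unfolding D_def
        by (intro continuous_intros contIb)
      have "(D has_real_derivative 0) (at s)" if "0 < s" for s
      proof -
        have "((\<lambda>s. I (s + T)) has_real_derivative h (s + T)) (at s)"
          using derI[of "s+T"] that T by (simp add: DERIV_shift)
        then have "(D has_real_derivative (h (s+T) - h s)) (at s)"
          unfolding D_def by (intro derivative_intros derI that)
        then show ?thesis using per that by simp
      qed
      then show ?thesis using DERIV_isconst2[OF _ c, of r] False that by auto
    qed simp
    then show ?thesis using int0 by (simp add: D_def I_def)
  qed
  define c where "c = integral {0..T} I / T"
  show ?thesis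
  proof (rule that[of "\<lambda>r. I r - c"])
    have "integral {0..T} (\<lambda>r. I r - c) = 0"
      using T by (subst integral_diff) (auto intro!: integrable_continuous_real contIb simp: c_def)
    then show "zero_mean_on_period T (\<lambda>r. I r - c)"
      unfolding zero_mean_on_period_def using contI0 perI by (auto intro!: continuous_intros)
    show "\<forall>r>0. ((\<lambda>r. I r - c) has_real_derivative h r) (at r)"
      using derI by (auto intro!: derivative_eq_intros)
  qed
qed

text \<open>In logarithmic time, \<open>e\<^sup>-\<^sup>(\<^sup>j\<^sup>-\<^sup>1\<^sup>)\<^sup>t h(e\<^sup>t)\<close> differs from an exact derivative by a term that is smaller by
a factor \<open>e\<^sup>-\<^sup>t\<close>. This is the mechanism by which fast oscillation gains decay.\<close>
lemma deriv_decaying_periodic: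
  assumes "\<forall>r>0. (H has_real_derivative h r) (at r)"
  shows "((\<lambda>t. exp (- (j * t)) * H (exp t)) has_real_derivative
    (- j * (exp (- (j * t)) * H (exp t)) + exp (- ((j - 1) * t)) * h (exp t))) (at t)"
proof -
  have "((\<lambda>t. H (exp t)) has_real_derivative (h (exp t) * exp t)) (at t)"
    using DERIV_chain2[of H "h (exp t)" exp t "exp t"] assms by auto
  then have "((\<lambda>t. exp (- (j * t)) * H (exp t)) has_real_derivative
    (- j * exp (- (j * t)) * H (exp t) + exp (- (j * t)) * (h (exp t) * exp t))) (at t)"
    by (auto intro!: derivative_eq_intros)
  moreover have "exp (- (j * t)) * (h (exp t) * exp t) = exp (- ((j - 1) * t)) * h (exp t)"
    by (simp add: algebra_simps flip: exp_add)
  ultimately show ?thesis by (simp add: mult.assoc)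
qed

lemma bigo_decaying_periodic:
  assumes "T > 0" "zero_mean_on_period T H"
  shows "(\<lambda>t. exp (- (j * t)) * H (exp t)) \<in> O[at_top](\<lambda>t. exp (- (j * t)))"
proof -
  obtain B where "\<forall>r\<ge>0. \<bar>H r\<bar> \<le> B" using zero_mean_on_period_bounded[OF assms] .
  then show ?thesis by (intro bigoI[of _ B]) (auto simp: abs_mult mult.commute intro!: mult_right_mono)
qed

section \<open>Differential inequalities\<close>

lemma linear_comparison:
  fixes y y' :: "real \<Rightarrow> real"
  assumes "a > 0" and d: "\<And>t. t \<ge> 0 \<Longrightarrow> (y has_real_derivative y' t) (at t)"
    and ge: "\<And>t. t \<ge> 0 \<Longrightarrow> y' t \<ge> a * (b - y t)" and t: "t \<ge> 0"
  shows "y t \<ge> min (y 0) b"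
proof -
  have "exp (a * 0) * (y 0 - b) \<le> exp (a * t) * (y t - b)"
  proof (rule DERIV_nonneg_imp_nondecreasing[OF t])
    fix s :: real assume s: "0 \<le> s" "s \<le> t"
    have "((\<lambda>t. exp (a * t) * (y t - b)) has_real_derivative exp (a * s) * (y' s - a * (b - y s))) (at s)"
      using d[OF s(1)] by (auto intro!: derivative_eq_intros simp: algebra_simps)
    then show "\<exists>z. ((\<lambda>t. exp (a * t) * (y t - b)) has_real_derivative z) (at s) \<and> 0 \<le> z"
      using ge[OF s(1)] by (intro exI conjI) auto
  qed
  then have *: "y 0 - b \<le> exp (a * t) * (y t - b)" by simp
  show ?thesis
  proof (cases "y t \<ge> b")
    case False
    have "1 \<le> exp (a * t)" using assms t by simp
    then have "1 * (b - y t) \<le> exp (a * t) * (b - y t)" using False by (intro mult_right_mono) auto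
    then show ?thesis using * by (simp add: algebra_simps min_def)
  qed auto
qed

lemma linear_comparison_upper:
  fixes y y' :: "real \<Rightarrow> real"
  assumes "a > 0" and d: "\<And>t. t \<ge> 0 \<Longrightarrow> (y has_real_derivative y' t) (at t)"
    and le: "\<And>t. t \<ge> 0 \<Longrightarrow> y' t \<le> a * (b - y t)" and t: "t \<ge> 0"
  shows "y t \<le> max (y 0) b"
proof -
  have "- y t \<ge> min (- y 0) (- b)"
  proof (rule linear_comparison[OF assms(1) _ _ t])
    show "((\<lambda>t. - y t) has_real_derivative - y' t) (at t)" if "t \<ge> 0" for t
      using d[OF that] by (auto intro!: derivative_eq_intros)
    show "- y' t \<ge> a * (- b - - y t)" if "t \<ge> 0" for t using le[OF that] by (simp add: algebra_simps)
  qed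
  then show ?thesis by (auto simp: min_def max_def split: if_splits)
qed

text \<open>The forcing decays faster than the homogeneous rate \<open>c < 1\<close>, and adding the multiple
\<open>C/(1-c) e\<^sup>-\<^sup>t\<close> to \<open>W\<close> makes the inequality homogeneous. The application is to
a Lyapunov function with an oscillating correction, which may be negative.\<close>
lemma exponential_decay:
  fixes W W' :: "real \<Rightarrow> real"
  assumes c: "0 < c" "c < 1" and d: "\<And>t. t \<ge> t0 \<Longrightarrow> (W has_real_derivative W' t) (at t)"
    and le: "\<And>t. t \<ge> t0 \<Longrightarrow> W' t \<le> - c * W t + C * exp (- t)"
  obtains B where "\<And>t. t \<ge> t0 \<Longrightarrow> W t \<le> B * exp (- c * t)"
proof -
  have c1: "1 - c > 0" using c by simp
  define K where "K = C / (1 - c)"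
  have "K * (1 - c) = C" using c1 by (simp add: K_def)
  then have K: "C = K - c * K" by (simp add: algebra_simps)
  define G where "G t = exp (c * t) * W t + K * exp ((c - 1) * t)" for t
  have dec: "G t \<le> G t0" if t: "t \<ge> t0" for t
  proof (rule DERIV_nonpos_imp_nonincreasing[OF t])
    fix s assume s: "t0 \<le> s" "s \<le> t"
    have "(G has_real_derivative (exp (c * s) * W' s + c * exp (c * s) * W s - C * exp ((c - 1) * s))) (at s)"
      unfolding G_def K using d[OF s(1)]
      by (auto intro!: derivative_eq_intros simp: algebra_simps)
    moreover have "exp (c * s) * W' s + c * exp (c * s) * W s - C * exp ((c - 1) * s)
      = exp (c * s) * (W' s + c * W s - C * exp (- s))"
      by (simp add: algebra_simps flip: exp_add)
    moreover have "\<dots> \<le> 0" using le[OF s(1)] by (intro mult_nonneg_nonpos) auto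
    ultimately show "\<exists>y. (G has_real_derivative y) (at s) \<and> y \<le> 0" by auto
  qed
  have "W t \<le> (G t0 + \<bar>K\<bar> * exp ((c - 1) * t0)) * exp (- c * t)" if t: "t \<ge> t0" for t
  proof -
    have "exp ((c - 1) * t) \<le> exp ((c - 1) * t0)" using c t by (simp add: mult_left_mono_neg)
    then have "\<bar>K\<bar> * exp ((c - 1) * t) \<le> \<bar>K\<bar> * exp ((c - 1) * t0)"
      by (intro mult_left_mono) auto
    moreover have "- K * exp ((c - 1) * t) \<le> \<bar>K\<bar> * exp ((c - 1) * t)"
      by (intro mult_right_mono) auto
    ultimately have "exp (c * t) * W t \<le> G t0 + \<bar>K\<bar> * exp ((c - 1) * t0)"
      using dec[OF t] unfolding G_def by linarith
    then have "exp (c * t) * W t * exp (- c * t) \<le> (G t0 + \<bar>K\<bar> * exp ((c - 1) * t0)) * exp (- c * t)"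
      by (intro mult_right_mono) auto
    moreover have "exp (c * t) * W t * exp (- c * t) = W t"
      using exp_minus_inverse[of "c * t"] by simp
    ultimately show ?thesis by linarith
  qed
  then show ?thesis using that by blast
qed

text \<open>The energy \<open>E = e\<^sup>2\<^sup>\<mu>\<^sup>t (\<kappa> x\<^sup>2 + s\<^sup>2)\<close> is nonincreasing for the unperturbed system, because its
weights cancel the two coupling terms and \<open>\<nu> \<ge> \<mu>\<close>. The errors contribute at most
\<open>D e\<^sup>-\<^sup>\<delta>\<^sup>t (E + 1)\<close>, whose coefficient is integrable, so \<open>E\<close> stays bounded. The decay rate \<open>\<mu>\<close> is reached
without any loss: the relative size \<open>e\<^sup>-\<^sup>\<delta>\<^sup>t\<close> of the nonlinear errors suffices, for arbitrarily small \<open>\<delta>\<close>.\<close>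
lemma perturbed_oscillator_decay:
  fixes x s e1 e2 :: "real \<Rightarrow> real"
  assumes "\<mu> \<le> \<nu>" and kap: "\<kappa> > 0" and del: "\<delta> > 0"
    and dx: "\<And>t. t \<ge> t0 \<Longrightarrow> (x has_real_derivative - \<mu> * x t + s t + e1 t) (at t)"
    and ds: "\<And>t. t \<ge> t0 \<Longrightarrow> (s has_real_derivative - \<kappa> * x t - \<nu> * s t + e2 t) (at t)"
    and e1: "\<And>t. t \<ge> t0 \<Longrightarrow> \<bar>e1 t\<bar> \<le> C * (exp (- \<delta> * t) * (\<bar>x t\<bar> + \<bar>s t\<bar>) + exp (- (\<mu> + \<delta>) * t))"
    and e2: "\<And>t. t \<ge> t0 \<Longrightarrow> \<bar>e2 t\<bar> \<le> C * (exp (- \<delta> * t) * (\<bar>x t\<bar> + \<bar>s t\<bar>) + exp (- (\<mu> + \<delta>) * t))"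
  obtains B where "\<And>t. t \<ge> t0 \<Longrightarrow> \<bar>x t\<bar> \<le> B * exp (- \<mu> * t)"
proof -
  define E where "E t = exp (2 * \<mu> * t) * (\<kappa> * (x t)\<^sup>2 + (s t)\<^sup>2)" for t
  define D where "D = 2 * \<bar>C\<bar> * (3 * (\<kappa> + 1) * (1 + 1 / \<kappa>))"
  have D0: "D \<ge> 0" using kap by (simp add: D_def)
  have E0: "E t \<ge> 0" for t using kap by (simp add: E_def)
  have dE: "\<exists>E'. (E has_real_derivative E') (at t) \<and> E' \<le> D * exp (- \<delta> * t) * (E t + 1)" if t: "t \<ge> t0" for t
  proof -
    define a b where "a = exp (\<mu> * t) * \<bar>x t\<bar>" and "b = exp (\<mu> * t) * \<bar>s t\<bar>"
    have ab0: "a \<ge> 0" "b \<ge> 0" by (auto simp: a_def b_def)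
    have ex2: "exp (2 * \<mu> * t) = exp (\<mu> * t) * exp (\<mu> * t)" by (simp flip: exp_add)
    have "a\<^sup>2 = exp (2 * \<mu> * t) * (x t)\<^sup>2" "b\<^sup>2 = exp (2 * \<mu> * t) * (s t)\<^sup>2"
      by (simp_all add: a_def b_def ex2 power_mult_distrib power2_eq_square[of "exp (\<mu> * t)"])
    then have Eab: "E t = \<kappa> * a\<^sup>2 + b\<^sup>2" by (simp add: E_def algebra_simps)
    define E' where "E' = exp (2 * \<mu> * t) * (2 * (\<mu> - \<nu>) * (s t)\<^sup>2 + 2 * \<kappa> * x t * e1 t + 2 * s t * e2 t)"
    have der: "(E has_real_derivative E') (at t)"
      unfolding E_def E'_def using dx[OF t] ds[OF t]
      by (auto intro!: derivative_eq_intros simp: algebra_simps power2_eq_square)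
    have ce: "exp (\<mu> * t) * (C * (exp (- \<delta> * t) * (\<bar>x t\<bar> + \<bar>s t\<bar>) + exp (- (\<mu> + \<delta>) * t)))
       = C * exp (- \<delta> * t) * (a + b + 1)"
      by (simp add: a_def b_def algebra_simps flip: exp_add)
    have "exp (\<mu> * t) * \<bar>e\<bar> \<le> \<bar>C\<bar> * exp (- \<delta> * t) * (a + b + 1)"
      if "\<bar>e\<bar> \<le> C * (exp (- \<delta> * t) * (\<bar>x t\<bar> + \<bar>s t\<bar>) + exp (- (\<mu> + \<delta>) * t))" for e
    proof -
      have "exp (\<mu> * t) * \<bar>e\<bar> \<le> C * exp (- \<delta> * t) * (a + b + 1)"
        unfolding ce[symmetric] using that by (intro mult_left_mono) auto
      also have "\<dots> \<le> \<bar>C\<bar> * exp (- \<delta> * t) * (a + b + 1)" using ab0 by (intro mult_right_mono) auto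
      finally show ?thesis .
    qed
    note ee = this[OF e1[OF t]] this[OF e2[OF t]]
    have "exp (2 * \<mu> * t) * (2 * \<kappa> * x t * e1 t) \<le> 2 * \<kappa> * a * (exp (\<mu> * t) * \<bar>e1 t\<bar>)"
    proof -
      have "exp (2 * \<mu> * t) * (2 * \<kappa> * x t * e1 t) \<le> exp (2 * \<mu> * t) * (2 * \<kappa> * \<bar>x t * e1 t\<bar>)"
        using kap by (intro mult_left_mono) (auto simp: mult.assoc intro!: mult_left_mono)
      then show ?thesis unfolding ex2 a_def abs_mult by (simp only: mult_ac)
    qed
    also have "\<dots> \<le> 2 * \<kappa> * a * (\<bar>C\<bar> * exp (- \<delta> * t) * (a + b + 1))"
      using ee kap ab0 by (intro mult_left_mono) auto
    finally have t1: "exp (2 * \<mu> * t) * (2 * \<kappa> * x t * e1 t) \<le> 2 * \<kappa> * a * (\<bar>C\<bar> * exp (- \<delta> * t) * (a + b + 1))" .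
    have "exp (2 * \<mu> * t) * (2 * s t * e2 t) \<le> 2 * b * (exp (\<mu> * t) * \<bar>e2 t\<bar>)"
    proof -
      have "exp (2 * \<mu> * t) * (2 * s t * e2 t) \<le> exp (2 * \<mu> * t) * (2 * \<bar>s t * e2 t\<bar>)"
        by (intro mult_left_mono) (auto simp: mult.assoc intro!: mult_left_mono)
      then show ?thesis unfolding ex2 b_def abs_mult by (simp only: mult_ac)
    qed
    also have "\<dots> \<le> 2 * b * (\<bar>C\<bar> * exp (- \<delta> * t) * (a + b + 1))"
      using ee ab0 by (intro mult_left_mono) auto
    finally have t2: "exp (2 * \<mu> * t) * (2 * s t * e2 t) \<le> 2 * b * (\<bar>C\<bar> * exp (- \<delta> * t) * (a + b + 1))" .
    have t3: "exp (2 * \<mu> * t) * (2 * (\<mu> - \<nu>) * (s t)\<^sup>2) \<le> 0"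
      using assms(1) by (intro mult_nonneg_nonpos mult_nonpos_nonneg) auto
    have "E' \<le> 2 * \<bar>C\<bar> * exp (- \<delta> * t) * ((\<kappa> * a + b) * (a + b + 1))"
      using t1 t2 t3 unfolding E'_def distrib_left by (simp add: algebra_simps)
    also have "(\<kappa> * a + b) * (a + b + 1) \<le> 3 * (\<kappa> + 1) * (1 + 1 / \<kappa>) * (\<kappa> * a\<^sup>2 + b\<^sup>2 + 1)"
    proof -
      have "(\<kappa> * a + b) * (a + b + 1) \<le> ((\<kappa> + 1) * (a + b + 1)) * (a + b + 1)"
        using ab0 kap by (intro mult_right_mono) (auto simp: algebra_simps)
      also have "\<dots> \<le> (\<kappa> + 1) * (3 * (a\<^sup>2 + b\<^sup>2 + 1))"
      proof -
        have "(a + b + 1)\<^sup>2 \<le> 3 * (a\<^sup>2 + b\<^sup>2 + 1)"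
          using sum_squares_ge_zero[of "a-b" "a-1"] zero_le_power2[of "b-1"]
            zero_le_power2[of "a-b"] zero_le_power2[of "a-1"]
          by (simp add: power2_eq_square algebra_simps)
        then show ?thesis using kap by (simp add: power2_eq_square mult.assoc)
      qed
      also have "\<dots> \<le> (\<kappa> + 1) * (3 * ((1 + 1 / \<kappa>) * (\<kappa> * a\<^sup>2 + b\<^sup>2 + 1)))"
      proof -
        have "(1 + 1 / \<kappa>) * (\<kappa> * a\<^sup>2 + b\<^sup>2 + 1) = a\<^sup>2 + b\<^sup>2 + 1 + (\<kappa> * a\<^sup>2 + b\<^sup>2 / \<kappa> + 1 / \<kappa>)"
          using kap by (simp add: field_simps)
        moreover have "\<kappa> * a\<^sup>2 + b\<^sup>2 / \<kappa> + 1 / \<kappa> \<ge> 0" using kap by auto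
        ultimately show ?thesis using kap by (intro mult_left_mono) auto
      qed
      finally show ?thesis by (simp only: mult_ac)
    qed
    finally have "E' \<le> D * exp (- \<delta> * t) * (E t + 1)"
      by (simp add: Eab D_def mult_left_mono mult.assoc mult.left_commute)
    then show ?thesis using der by blast
  qed
  define G where "G t = (E t + 1) * exp (D / \<delta> * exp (- \<delta> * t))" for t
  have dec: "G t \<le> G t0" if t: "t \<ge> t0" for t
  proof (rule DERIV_nonpos_imp_nonincreasing[OF t])
    fix r assume r: "t0 \<le> r" "r \<le> t"
    obtain E' where E': "(E has_real_derivative E') (at r)" "E' \<le> D * exp (- \<delta> * r) * (E r + 1)"
      using dE[OF r(1)] by blast
    have "(G has_real_derivative (E' - D * exp (- \<delta> * r) * (E r + 1)) * exp (D / \<delta> * exp (- \<delta> * r))) (at r)"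
      unfolding G_def using E'(1) del by (auto intro!: derivative_eq_intros simp: algebra_simps)
    then show "\<exists>y. (G has_real_derivative y) (at r) \<and> y \<le> 0"
      using E'(2) by (intro exI conjI) (auto intro!: mult_nonpos_nonneg)
  qed
  have "\<bar>x t\<bar> \<le> sqrt (G t0 / \<kappa>) * exp (- \<mu> * t)" if t: "t \<ge> t0" for t
  proof -
    have "E t + 1 \<le> G t" unfolding G_def using E0[of t] D0 del
      by (simp add: mult_le_cancel_left1)
    then have "E t \<le> G t0" using dec[OF t] by linarith
    moreover have "\<kappa> * (exp (\<mu> * t) * x t)\<^sup>2 \<le> E t"
      by (simp add: E_def power_mult_distrib distrib_left exp_double[symmetric] mult.assoc mult.left_commute)
    ultimately have "(exp (\<mu> * t) * x t)\<^sup>2 \<le> G t0 / \<kappa>" using kap by (simp add: field_simps)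
    then have "\<bar>exp (\<mu> * t) * x t\<bar> \<le> sqrt (G t0 / \<kappa>)" using real_le_rsqrt by fastforce
    then have "exp (\<mu> * t) * \<bar>x t\<bar> * exp (- \<mu> * t) \<le> sqrt (G t0 / \<kappa>) * exp (- \<mu> * t)"
      by (intro mult_right_mono) (auto simp: abs_mult)
    moreover have "exp (\<mu> * t) * \<bar>x t\<bar> * exp (- \<mu> * t) = \<bar>x t\<bar>"
      using exp_minus_inverse[of "\<mu> * t"] by simp
    ultimately show ?thesis by linarith
  qed
  then show ?thesis using that by blast
qed

section \<open>Convexity estimates for the Lyapunov function\<close>

text \<open>The difference \<open>f x - c (x - 1)\<^sup>2\<close> is convex and has a horizontal tangent at \<open>1\<close>.\<close>
lemma quadratic_lower_bound:
  fixes f f' f'' :: "real \<Rightarrow> real"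
  assumes d1: "\<And>x. x > 0 \<Longrightarrow> (f has_real_derivative f' x) (at x)"
    and d2: "\<And>x. x > 0 \<Longrightarrow> (f' has_real_derivative f'' x) (at x)"
    and "f 1 = 0" "f' 1 = 0" and lb: "\<And>x. 0 < x \<Longrightarrow> x < u \<Longrightarrow> f'' x \<ge> 2 * c"
    and "1 < u" "0 < x" "x < u"
  shows "f x \<ge> c * (x - 1)\<^sup>2"
proof -
  define g where "g x = f x - c * (x - 1)\<^sup>2" for x
  have dg: "(g has_real_derivative (f' y - 2 * c * (y - 1))) (at y)" if "y > 0" for y
    unfolding g_def using d1[OF that] by (auto intro!: derivative_eq_intros)
  have "convex_on {0<..<u} g"
  proof (rule f''_ge0_imp_convex)
    show "(g has_real_derivative (f' y - 2 * c * (y - 1))) (at y)" if "y \<in> {0<..<u}" for y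
      using dg that by auto
    show "((\<lambda>y. f' y - 2 * c * (y - 1)) has_real_derivative (f'' y - 2 * c)) (at y)" if "y \<in> {0<..<u}" for y
      using d2[of y] that by (auto intro!: derivative_eq_intros)
  qed (use lb in auto)
  moreover have "(g has_real_derivative 0) (at 1 within {0<..<u})"
    using dg[of 1] assms(4) by (auto intro: has_field_derivative_at_within)
  moreover have "1 \<in> interior {0<..<u}" using assms by (simp add: interior_open)
  ultimately have "g x - g 1 \<ge> 0 * (x - 1)"
    by (intro convex_on_imp_above_tangent[of "{0<..<u}"]) (use assms in auto)
  then show ?thesis using assms(3) by (simp add: g_def)
qed

lemma entropy_upper:
  assumes "(x::real) > 0" shows "x - ln x - 1 \<le> (x - 1)\<^sup>2 / x"
proof -
  have "ln (1 / x) \<le> 1 / x - 1" using assms by (intro ln_le_minus_one) auto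
  then have "x - ln x - 1 \<le> x - 1 + (1 / x - 1)" using assms by (simp add: ln_div)
  also have "\<dots> = (x - 1)\<^sup>2 / x" using assms by (simp add: field_simps power2_eq_square)
  finally show ?thesis .
qed

lemma entropy_lower:
  assumes "0 < (x::real)" "x < u" "1 < u" shows "x - ln x - 1 \<ge> 1 / (2 * u\<^sup>2) * (x - 1)\<^sup>2"
proof (rule quadratic_lower_bound[where f' = "\<lambda>x. 1 - 1 / x" and f'' = "\<lambda>x. 1 / x\<^sup>2" and u = u])
  fix y :: real assume y: "0 < y" "y < u"
  show "2 * (1 / (2 * u\<^sup>2)) \<le> 1 / y\<^sup>2" using y by (simp add: frac_le power_mono)
qed (use assms in \<open>auto intro!: derivative_eq_intros simp: power2_eq_square field_simps\<close>)

text \<open>The integral of \<open>x\<^sup>e - 1\<close> from \<open>1\<close>: the part of the Lyapunov function that depends on \<open>q\<close>.\<close>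
definition power_gap :: "real \<Rightarrow> real \<Rightarrow> real" where
  "power_gap e x = (x powr (1 + e) - 1) / (1 + e) - (x - 1)"

lemma power_gap_deriv:
  assumes "x > 0" "e > 0"
  shows "(power_gap e has_real_derivative (x powr e - 1)) (at x)"
  unfolding power_gap_def using assms by (auto intro!: derivative_eq_intros)

lemma power_gap_deriv2:
  assumes "x > 0"
  shows "((\<lambda>x. x powr e - 1) has_real_derivative (e * x powr (e - 1))) (at x)"
  using assms by (auto intro!: derivative_eq_intros)

lemma power_gap_upper:
  assumes "x > 0" "e > 0"
  shows "power_gap e x \<le> (x powr e - 1) * (x - 1)"
proof -
  have "convex_on {0<..} (power_gap e)"
    by (rule f''_ge0_imp_convex[OF _ power_gap_deriv power_gap_deriv2]) (use assms in auto)
  then have "power_gap e 1 - power_gap e x \<ge> (x powr e - 1) * (1 - x)"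
    by (rule convex_on_imp_above_tangent)
      (use assms power_gap_deriv[OF assms] in \<open>auto simp: interior_open intro: has_field_derivative_at_within\<close>)
  then show ?thesis by (simp add: power_gap_def algebra_simps)
qed

lemma power_gap_lower:
  assumes "0 < x" "x < u" "1 < u" "0 < e" "e \<le> 1"
  shows "power_gap e x \<ge> e * u powr (e - 1) / 2 * (x - 1)\<^sup>2"
proof (rule quadratic_lower_bound[OF power_gap_deriv power_gap_deriv2, where u = u])
  fix y :: real assume y: "0 < y" "y < u"
  have "u powr (e - 1) \<le> y powr (e - 1)" using y assms by (intro powr_mono2') auto
  then show "2 * (e * u powr (e - 1) / 2) \<le> e * y powr (e - 1)" using assms by simp
qed (use assms in \<open>auto simp: power_gap_def\<close>)

section \<open>Asymptotic comparison\<close>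

lemma bigo_1_of_bounds:
  fixes f :: "real \<Rightarrow> real"
  assumes "\<And>t. t \<ge> t0 \<Longrightarrow> l \<le> f t \<and> f t \<le> u"
  shows "f \<in> O[at_top](\<lambda>_. 1)"
proof (rule bigoI[of _ "\<bar>l\<bar> + \<bar>u\<bar>"])
  show "\<forall>\<^sub>F t in at_top. norm (f t) \<le> (\<bar>l\<bar> + \<bar>u\<bar>) * norm (1::real)"
    using eventually_ge_at_top[of t0] by eventually_elim (use assms in force)
qed

lemma bigo_sqrt_exp:
  fixes x V :: "real \<Rightarrow> real"
  assumes "c > 0" and "\<And>t. t \<ge> t0 \<Longrightarrow> c * (x t)\<^sup>2 \<le> V t" and "\<And>t. t \<ge> t0 \<Longrightarrow> V t \<le> B * exp (- (2 * \<delta> * t))"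
  shows "x \<in> O[at_top](\<lambda>t. exp (- (\<delta> * t)))"
proof (rule bigoI[of _ "sqrt (\<bar>B\<bar> / c)"])
  show "\<forall>\<^sub>F t in at_top. norm (x t) \<le> sqrt (\<bar>B\<bar> / c) * norm (exp (- (\<delta> * t)))"
    using eventually_ge_at_top[of t0]
  proof eventually_elim
    case (elim t)
    have "c * (x t)\<^sup>2 \<le> \<bar>B\<bar> * exp (- (2 * \<delta> * t))"
      using assms(2,3)[OF elim] by (meson abs_ge_self exp_ge_zero mult_right_mono order_trans)
    also have "exp (- (2 * \<delta> * t)) = (exp (- (\<delta> * t)))\<^sup>2"
      by (simp add: power2_eq_square flip: exp_add)
    finally have "(x t)\<^sup>2 \<le> (\<bar>B\<bar> / c) * (exp (- (\<delta> * t)))\<^sup>2" using assms(1) by (simp add: field_simps)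
    then have "sqrt ((x t)\<^sup>2) \<le> sqrt ((\<bar>B\<bar> / c) * (exp (- (\<delta> * t)))\<^sup>2)" by (rule real_sqrt_le_mono)
    then show ?case unfolding real_sqrt_mult by simp
  qed
qed

lemma bigo_absorb_times:
  fixes f g a :: "real \<Rightarrow> real"
  assumes "f \<in> O[F](E)" "(\<lambda>t. E t * \<bar>a t\<bar>) \<in> O[F](g)"
  shows "(\<lambda>t. f t * a t) \<in> O[F](g)"
proof -
  have "(\<lambda>t. f t * \<bar>a t\<bar>) \<in> O[F](\<lambda>t. E t * \<bar>a t\<bar>)" using assms(1) by simp
  then have "(\<lambda>t. f t * \<bar>a t\<bar>) \<in> O[F](g)" using assms(2) by (rule landau_o.big_trans)
  then show ?thesis by (subst (asm) landau_o.big.norm_iff[symmetric], subst landau_o.big.norm_iff[symmetric])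
    (simp add: abs_mult)
qed

lemma bigo_at_imp_nhds:
  fixes f g :: "real \<Rightarrow> real"
  assumes "f \<in> O[at x](g)" "f x = 0"
  shows "f \<in> O[nhds x](g)"
proof -
  obtain c where "\<forall>\<^sub>F y in at x. norm (f y) \<le> c * norm (g y)" "c > 0"
    using assms(1) by (elim landau_o.bigE)
  then have "\<forall>\<^sub>F y in nhds x. y \<noteq> x \<longrightarrow> norm (f y) \<le> c * norm (g y)" by (simp add: eventually_at_filter)
  then show ?thesis using assms(2) \<open>c > 0\<close>
    by (intro bigoI[of _ c]) (auto elim!: eventually_mono)
qed

lemma powr_expansion_1:
  fixes a :: real
  shows "(\<lambda>y. (1 + y) powr a - 1) \<in> O[nhds 0](\<lambda>y. y)"
  by (rule bigo_at_imp_nhds) (real_asymp, simp)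

text \<open>The quadratic term is kept explicitly: applied to a perturbation of size \<open>e\<^sup>-\<^sup>t\<close> it has the borderline
size \<open>e\<^sup>-\<^sup>2\<^sup>t\<close>, while the cubic remainder is harmless.\<close>
lemma powr_expansion_3:
  fixes a :: real
  shows "(\<lambda>y. (1 + y) powr a - 1 - a * y - a * (a - 1) / 2 * y ^ 2) \<in> O[nhds 0](\<lambda>y. y ^ 3)"
  by (rule bigo_at_imp_nhds) (real_asymp, simp)

lemma decaying_tendsto_0:
  fixes f :: "real \<Rightarrow> real"
  assumes "f \<in> O[at_top](\<lambda>t. exp (- (\<delta> * t)))" "\<delta> > 0"
  shows "filterlim f (nhds 0) at_top"
proof -
  have "(\<lambda>t. exp (- (\<delta> * t))) \<in> o[at_top](\<lambda>_. 1 :: real)" using assms(2) by real_asymp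
  then have "f \<in> o[at_top](\<lambda>_. 1)" using assms(1) by (rule landau_o.big_small_trans[rotated])
  then show ?thesis using smalloD_tendsto by fastforce
qed

section \<open>The radial equation in logarithmic time\<close>

text \<open>The equation for \<open>v\<close>, with \<open>t = ln r\<close> and both unknowns divided by their expected leading powers of
\<open>r\<close>. The normalisations make \<open>\<phi>\<close> have mean \<open>1\<close> and put the averaged equilibrium at \<open>p = q = 1\<close>. The
dimension enters through \<open>\<gamma>\<close> only: \<open>n = \<beta> + \<gamma>\<close>.\<close>
locale profile_system =
  fixes k :: nat and \<beta> \<gamma> T :: real and \<phi> p q :: "real \<Rightarrow> real"
  assumes k: "1 \<le> k" and beta: "\<beta> = 2 * real k / (real k + 1)" and gamma: "\<gamma> > 0" and T: "T > 0"
    and phi_cont: "continuous_on {0..} \<phi>" and phi_pos: "\<forall>r\<ge>0. \<phi> r > 0"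
    and phi_per: "\<forall>r\<ge>0. \<phi> (r + T) = \<phi> r" and phi_mean: "integral {0..T} \<phi> = T"
    and p_pos: "p t > 0" and q_pos: "q t > 0"
    and dp: "(p has_real_derivative \<beta> * (q t powr (1 / real k) - p t)) (at t)"
    and dq: "(q has_real_derivative \<gamma> * (\<phi> (exp t) / p t - q t)) (at t)"
begin

abbreviation e :: real where "e \<equiv> 1 / real k"

lemma e: "0 < e" "e \<le> 1" and beta_e: "\<beta> * (1 + e) = 2" and beta_pos: "\<beta> > 0"
proof -
  show "0 < e" "e \<le> 1" using k by auto
  have "1 + e = (real k + 1) / real k" using k by (simp add: field_simps)
  then show "\<beta> * (1 + e) = 2" using k by (simp add: beta)
  show "\<beta> > 0" using k by (simp add: beta)
qed

text \<open>In these variables the equation of \<open>P\<close> is linear in \<open>P\<close>, and \<open>\<phi>\<close> enters the equation of \<open>Z\<close> additively,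
without the factor \<open>1/p\<close>.\<close>
definition P where "P t = p t powr (1 + e)"
definition Z where "Z t = p t * q t"

lemma P_pos: "P t > 0" and Z_pos: "Z t > 0"
  using p_pos[of t] q_pos[of t] by (auto simp: P_def Z_def)

lemma dP: "(P has_real_derivative 2 * (Z t powr e - P t)) (at t)"
proof -
  have "(P has_real_derivative (1 + e) * p t powr e * (\<beta> * (q t powr e - p t))) (at t)"
    unfolding P_def using dp[of t] p_pos[of t]
    by (auto intro!: derivative_eq_intros)
  moreover have "(1 + e) * p t powr e * (\<beta> * (q t powr e - p t)) = (\<beta> * (1 + e)) * (Z t powr e - P t)"
    using p_pos[of t] q_pos[of t] by (simp add: P_def Z_def powr_mult powr_add algebra_simps)
  ultimately show ?thesis by (simp add: beta_e)
qed

lemma dZ: "(Z has_real_derivative \<gamma> * \<phi> (exp t) - (\<beta> + \<gamma>) * Z t + \<beta> * (Z t powr (1 + e) / P t)) (at t)"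
proof -
  have "(Z has_real_derivative \<beta> * (q t powr e - p t) * q t + p t * (\<gamma> * (\<phi> (exp t) / p t - q t))) (at t)"
    unfolding Z_def using dp[of t] dq[of t] by (auto intro!: derivative_eq_intros)
  moreover have "Z t powr (1 + e) / P t = q t powr e * q t"
    using p_pos[of t] q_pos[of t] by (simp add: P_def Z_def powr_mult powr_add)
  moreover have "\<beta> * (q t powr e - p t) * q t + p t * (\<gamma> * (\<phi> (exp t) / p t - q t))
    = \<gamma> * \<phi> (exp t) - (\<beta> + \<gamma>) * Z t + \<beta> * (q t powr e * q t)"
    using p_pos[of t] by (simp add: Z_def algebra_simps)
  ultimately show ?thesis by simp
qed

text \<open>Since \<open>\<phi>\<close> is bounded away from \<open>0\<close>, so is \<open>Z\<close>; its lower bound drives \<open>P\<close> away from \<open>0\<close>. A lower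
bound for \<open>p\<close> limits the source in the equation of \<open>q\<close>, and the upper bound for \<open>q\<close> limits \<open>p\<close>. The bound
from below for \<open>q\<close> then follows from the one for \<open>Z = p q\<close>.\<close>
lemma a_priori_bounds:
  obtains l u m where "0 < l" "1 < u" "\<And>t. t \<ge> 0 \<Longrightarrow> l \<le> p t \<and> p t < u \<and> l \<le> q t \<and> q t < u"
    "\<forall>r\<ge>0. 0 \<le> \<phi> r \<and> \<phi> r \<le> m"
proof -
  obtain a b where ab: "0 \<le> a" "0 \<le> b" "\<forall>r\<ge>0. \<phi> a \<le> \<phi> r \<and> \<phi> r \<le> \<phi> b"
    using periodic_attains_bounds[OF T phi_cont phi_per] by blast
  have pos: "\<phi> a > 0" "\<phi> b > 0" using phi_pos ab by auto
  define z where "z = min (Z 0) (\<gamma> * \<phi> a / (\<beta> + \<gamma>))"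
  have z0: "z > 0" using Z_pos[of 0] pos gamma beta_pos by (simp add: z_def)
  have Zlow: "Z t \<ge> z" if t: "t \<ge> 0" for t
    unfolding z_def
  proof (rule linear_comparison[OF _ dZ _ t])
    fix s :: real assume "s \<ge> 0"
    have "\<gamma> * \<phi> a \<le> \<gamma> * \<phi> (exp s)" using ab gamma by auto
    moreover have "0 \<le> \<beta> * (Z s powr (1 + e) / P s)" using beta_pos P_pos[of s] by auto
    moreover have "(\<beta> + \<gamma>) * (\<gamma> * \<phi> a / (\<beta> + \<gamma>) - Z s) = \<gamma> * \<phi> a - (\<beta> + \<gamma>) * Z s"
      using gamma beta_pos by (simp add: right_diff_distrib)
    ultimately show "(\<beta> + \<gamma>) * (\<gamma> * \<phi> a / (\<beta> + \<gamma>) - Z s)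
       \<le> \<gamma> * \<phi> (exp s) - (\<beta> + \<gamma>) * Z s + \<beta> * (Z s powr (1 + e) / P s)"
      by linarith
  qed (use gamma beta_pos in auto)
  define P1 where "P1 = min (P 0) (z powr e)"
  have Plow: "P t \<ge> P1" if t: "t \<ge> 0" for t
    unfolding P1_def
  proof (rule linear_comparison[OF _ dP _ t])
    fix s :: real assume "s \<ge> 0"
    then have "z powr e \<le> Z s powr e" using Zlow[of s] z0 e by (intro powr_mono2) auto
    then show "2 * (z powr e - P s) \<le> 2 * (Z s powr e - P s)" by simp
  qed auto
  define p1 where "p1 = P1 powr (1 / (1 + e))"
  have P1: "P1 > 0" using P_pos[of 0] z0 by (simp add: P1_def)
  have p1: "p1 > 0" using P1 by (simp add: p1_def)
  have plow: "p t \<ge> p1" if t: "t \<ge> 0" for t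
  proof -
    have "p1 \<le> P t powr (1 / (1 + e))"
      unfolding p1_def using Plow[OF t] P1 e by (intro powr_mono2) auto
    also have "\<dots> = p t"
    proof -
      have "1 + e \<noteq> 0" using e by linarith
      then show ?thesis using p_pos[of t] by (simp add: P_def powr_powr)
    qed
    finally show ?thesis .
  qed
  define q2 where "q2 = max (q 0) (\<phi> b / p1)"
  have qup: "q t \<le> q2" if t: "t \<ge> 0" for t
    unfolding q2_def
  proof (rule linear_comparison_upper[OF gamma dq _ t])
    fix s :: real assume s: "s \<ge> 0"
    have "\<phi> (exp s) / p s \<le> \<phi> b / p1" using ab plow[OF s] p1 pos by (intro frac_le) auto
    then show "\<gamma> * (\<phi> (exp s) / p s - q s) \<le> \<gamma> * (\<phi> b / p1 - q s)" using gamma by simp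
  qed
  define p2 where "p2 = max (p 0) (q2 powr e)"
  have pup: "p t \<le> p2" if t: "t \<ge> 0" for t
    unfolding p2_def
  proof (rule linear_comparison_upper[OF beta_pos dp _ t])
    fix s :: real assume s: "s \<ge> 0"
    have "q s powr e \<le> q2 powr e" using qup[OF s] q_pos[of s] e by (intro powr_mono2) auto
    then show "\<beta> * (q s powr e - p s) \<le> \<beta> * (q2 powr e - p s)" using beta_pos by simp
  qed
  have p2: "p2 > 0" using p_pos[of 0] by (simp add: p2_def)
  have qlow: "q t \<ge> z / p2" if t: "t \<ge> 0" for t
  proof -
    have "z \<le> p2 * q t" using Zlow[OF t] pup[OF t] q_pos[of t]
      by (auto simp: Z_def intro: order_trans mult_right_mono)
    then show ?thesis using p2 by (simp add: field_simps)
  qed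
  show ?thesis
  proof (rule that[of "min p1 (z / p2)" "2 + max p2 q2" "\<phi> b"])
    show "0 < min p1 (z / p2)" using p1 p2 z0 by simp
    show "1 < 2 + max p2 q2" using p2 by auto
    show "min p1 (z / p2) \<le> p t \<and> p t < 2 + max p2 q2 \<and> min p1 (z / p2) \<le> q t \<and> q t < 2 + max p2 q2"
      if "t \<ge> 0" for t using plow[OF that] qlow[OF that] pup[OF that] qup[OF that] by auto
    show "\<forall>r\<ge>0. 0 \<le> \<phi> r \<and> \<phi> r \<le> \<phi> b" using ab phi_pos by (auto intro: less_imp_le)
  qed
qed

lemma zero_mean_phi: "zero_mean_on_period T (\<lambda>r. \<phi> r - 1)"
proof -
  have "continuous_on {0..T} \<phi>" using phi_cont continuous_on_subset by fastforce
  then have "integral {0..T} (\<lambda>r. \<phi> r - 1) = 0"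
    using T phi_mean by (subst integral_diff) (auto intro!: integrable_continuous_real)
  then show ?thesis unfolding zero_mean_on_period_def using phi_cont phi_per
    by (auto intro!: continuous_intros)
qed

text \<open>Along the averaged system, \<open>V' = - \<beta> \<gamma> D\<close>: the weights \<open>\<gamma>\<close> and \<open>\<beta>\<close> in \<open>V\<close> are chosen so that the
terms mixing \<open>p\<close> and \<open>q\<close> cancel. The oscillating part of \<open>\<phi>\<close> is absorbed into the correction
\<open>W = V - \<beta> \<gamma> A B\<close>, which differs from \<open>V\<close> by \<open>O(e\<^sup>-\<^sup>t)\<close>. The rate is half that of \<open>V\<close>, which is
quadratic near the equilibrium.\<close>
lemma exponential_convergence:
  obtains \<delta> where "0 < \<delta>" "\<delta> \<le> 1"
    "(\<lambda>t. p t - 1) \<in> O[at_top](\<lambda>t. exp (- (\<delta> * t)))"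
    "(\<lambda>t. q t - 1) \<in> O[at_top](\<lambda>t. exp (- (\<delta> * t)))"
proof -
  obtain l u m where lu: "0 < l" "1 < u" "\<And>t. t \<ge> 0 \<Longrightarrow> l \<le> p t \<and> p t < u \<and> l \<le> q t \<and> q t < u"
    "\<forall>r\<ge>0. 0 \<le> \<phi> r \<and> \<phi> r \<le> m" using a_priori_bounds by blast
  obtain H where H: "zero_mean_on_period T H" "\<forall>r>0. (H has_real_derivative \<phi> r - 1) (at r)"
    using zero_mean_on_period_primitive[OF T zero_mean_phi] by blast
  define A where "A t = exp (- t) * H (exp t)" for t
  have dA: "(A has_real_derivative (- A t + (\<phi> (exp t) - 1))) (at t)" for t
    using deriv_decaying_periodic[OF H(2), of 1 t] by (simp add: A_def[abs_def])
  have A_bigo: "A \<in> O[at_top](\<lambda>t. exp (- t))"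
    using bigo_decaying_periodic[OF T H(1), of 1] by (simp add: A_def[abs_def])
  define V where "V t = \<gamma> * (p t - ln (p t) - 1) + \<beta> * power_gap e (q t)" for t
  define D where "D t = (p t - 1)\<^sup>2 / p t + (q t powr e - 1) * (q t - 1)" for t
  have dV: "(V has_real_derivative - (\<beta> * \<gamma> * D t) + \<beta> * \<gamma> * ((q t powr e - 1) / p t * (\<phi> (exp t) - 1))) (at t)" for t
  proof -
    have "(V has_real_derivative
       \<gamma> * ((1 - 1 / p t) * (\<beta> * (q t powr e - p t)))
       + \<beta> * ((q t powr e - 1) * (\<gamma> * (\<phi> (exp t) / p t - q t)))) (at t)"
    proof -
      have "((\<lambda>t. power_gap e (q t)) has_real_derivative (q t powr e - 1) * (\<gamma> * (\<phi> (exp t) / p t - q t))) (at t)"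
        using DERIV_chain2[OF power_gap_deriv[OF q_pos e(1)] dq] .
      moreover have "((\<lambda>t. p t - ln (p t) - 1) has_real_derivative (1 - 1 / p t) * (\<beta> * (q t powr e - p t))) (at t)"
        using dp[of t] p_pos[of t] by (auto intro!: derivative_eq_intros simp: field_simps)
      ultimately show ?thesis unfolding V_def by (intro DERIV_add DERIV_cmult)
    qed
    moreover have "\<gamma> * ((1 - 1 / p t) * (\<beta> * (q t powr e - p t)))
       + \<beta> * ((q t powr e - 1) * (\<gamma> * (\<phi> (exp t) / p t - q t)))
      = - (\<beta> * \<gamma> * D t) + \<beta> * \<gamma> * ((q t powr e - 1) / p t * (\<phi> (exp t) - 1))"
      using p_pos[of t] unfolding D_def by (simp add: field_simps power2_eq_square)
    ultimately show ?thesis by simp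
  qed
  \<comment> \<open>Convexity: a convex function lies above its tangents, so each summand of \<open>V\<close> is dominated by its
    counterpart in the dissipation \<open>D\<close>.\<close>
  have V_le_D: "V t \<le> (\<beta> + \<gamma>) * D t" for t
  proof -
    have 1: "p t - ln (p t) - 1 \<le> (p t - 1)\<^sup>2 / p t" by (rule entropy_upper[OF p_pos])
    have 2: "power_gap e (q t) \<le> (q t powr e - 1) * (q t - 1)" by (rule power_gap_upper[OF q_pos e(1)])
    have 3: "0 \<le> (p t - 1)\<^sup>2 / p t" using p_pos[of t] by simp
    have 4: "0 \<le> (q t powr e - 1) * (q t - 1)"
    proof (cases "q t \<ge> 1")
      case True then show ?thesis using e by (simp add: ge_one_powr_ge_zero)
    next
      case False then show ?thesis using e q_pos[of t] by (intro mult_nonpos_nonpos) (auto intro: powr_le1)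
    qed
    have "0 \<le> \<beta> * ((p t - 1)\<^sup>2 / p t)" "0 \<le> \<gamma> * ((q t powr e - 1) * (q t - 1))"
      using mult_nonneg_nonneg[OF less_imp_le[OF beta_pos] 3]
        mult_nonneg_nonneg[OF less_imp_le[OF gamma] 4] by blast+
    moreover have "\<gamma> * (p t - ln (p t) - 1) \<le> \<gamma> * ((p t - 1)\<^sup>2 / p t)"
      by (rule mult_left_mono[OF 1 less_imp_le[OF gamma]])
    moreover have "\<beta> * power_gap e (q t) \<le> \<beta> * ((q t powr e - 1) * (q t - 1))" using 2 beta_pos by simp
    ultimately show ?thesis unfolding V_def D_def distrib_left distrib_right by linarith
  qed
  define a where "a = min (1 / (2 * u\<^sup>2) * \<gamma>) (e * u powr (e - 1) / 2 * \<beta>)"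
  have a: "a > 0" using lu e gamma beta_pos by (simp add: a_def)
  have V_ge: "a * (p t - 1)\<^sup>2 \<le> V t" "a * (q t - 1)\<^sup>2 \<le> V t" "0 \<le> V t" if t: "t \<ge> 0" for t
  proof -
    have "1 / (2 * u\<^sup>2) * (p t - 1)\<^sup>2 \<le> p t - ln (p t) - 1"
      using entropy_lower[OF p_pos _ lu(2)] lu(3)[OF t] by blast
    then have "\<gamma> * (1 / (2 * u\<^sup>2) * (p t - 1)\<^sup>2) \<le> \<gamma> * (p t - ln (p t) - 1)"
      using gamma by (intro mult_left_mono) auto
    moreover have "a * (p t - 1)\<^sup>2 \<le> (1 / (2 * u\<^sup>2) * \<gamma>) * (p t - 1)\<^sup>2"
      unfolding a_def by (intro mult_right_mono) auto
    ultimately have 1: "a * (p t - 1)\<^sup>2 \<le> \<gamma> * (p t - ln (p t) - 1)" by (simp add: mult_ac)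
    have "e * u powr (e - 1) / 2 * (q t - 1)\<^sup>2 \<le> power_gap e (q t)"
      using power_gap_lower[OF q_pos _ lu(2) e] lu(3)[OF t] by blast
    then have "\<beta> * (e * u powr (e - 1) / 2 * (q t - 1)\<^sup>2) \<le> \<beta> * power_gap e (q t)"
      using beta_pos by (intro mult_left_mono) auto
    moreover have "a * (q t - 1)\<^sup>2 \<le> (e * u powr (e - 1) / 2 * \<beta>) * (q t - 1)\<^sup>2"
      unfolding a_def by (intro mult_right_mono) auto
    ultimately have 2: "a * (q t - 1)\<^sup>2 \<le> \<beta> * power_gap e (q t)" by (simp add: mult_ac)
    have "0 \<le> a * (p t - 1)\<^sup>2" "0 \<le> a * (q t - 1)\<^sup>2" using a by simp_all
    then show "a * (p t - 1)\<^sup>2 \<le> V t" "a * (q t - 1)\<^sup>2 \<le> V t" "0 \<le> V t"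
      using 1 2 unfolding V_def by linarith+
  qed
  \<comment> \<open>The oscillating forcing of \<open>V\<close> is \<open>\<beta> \<gamma> B (\<phi>(e\<^sup>t) - 1)\<close>; integrating it by parts moves the derivative from
    \<open>A\<close> to the factor \<open>B\<close>, which varies at a bounded rate.\<close>
  define B where "B t = (q t powr e - 1) / p t" for t
  define B' where "B' t = (e * q t powr (e - 1) * (\<gamma> * (\<phi> (exp t) / p t - q t)) * p t
      - (q t powr e - 1) * (\<beta> * (q t powr e - p t))) / (p t * p t)" for t
  have dB: "(B has_real_derivative B' t) (at t)" for t
    unfolding B_def B'_def
    using DERIV_chain2[OF power_gap_deriv2[OF q_pos, where e = e] dq] dp[of t] p_pos[of t]
    by (intro DERIV_divide) auto
  have o1: "p \<in> O[at_top](\<lambda>_. 1)" "q \<in> O[at_top](\<lambda>_. 1)"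
    "(\<lambda>t. \<phi> (exp t)) \<in> O[at_top](\<lambda>_. 1)"
  proof -
    show "p \<in> O[at_top](\<lambda>_. 1)"
      by (rule bigo_1_of_bounds[of 0 l p u]) (use lu(3) in \<open>simp add: less_imp_le\<close>)
    show "q \<in> O[at_top](\<lambda>_. 1)"
      by (rule bigo_1_of_bounds[of 0 l q u]) (use lu(3) in \<open>simp add: less_imp_le\<close>)
    show "(\<lambda>t. \<phi> (exp t)) \<in> O[at_top](\<lambda>_. 1)"
      by (rule bigo_1_of_bounds[of 0 0 _ m]) (use lu(4) in simp)
  qed
  have o2: "(\<lambda>t. q t powr e) \<in> O[at_top](\<lambda>_. 1)" "(\<lambda>t. q t powr (e - 1)) \<in> O[at_top](\<lambda>_. 1)"
     "(\<lambda>t. 1 / p t) \<in> O[at_top](\<lambda>_. 1)"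
  proof -
    have le: "l \<le> p t" "l \<le> q t" "q t \<le> u" if "t \<ge> 0" for t
      using lu(3)[OF that] by auto
    have "q t powr e \<le> u powr e" "q t powr (e - 1) \<le> l powr (e - 1)" "1 / p t \<le> 1 / l"
      "0 \<le> 1 / p t" if "t \<ge> 0" for t
    proof -
      show "q t powr e \<le> u powr e"
        using le[OF that] q_pos[of t] e by (intro powr_mono2) linarith+
      show "q t powr (e - 1) \<le> l powr (e - 1)"
        using le[OF that] lu(1) e by (intro powr_mono2') linarith+
      show "1 / p t \<le> 1 / l" "0 \<le> 1 / p t" using le[OF that] lu(1) by (simp_all add: frac_le)
    qed
    then show "(\<lambda>t. q t powr e) \<in> O[at_top](\<lambda>_. 1)" "(\<lambda>t. q t powr (e - 1)) \<in> O[at_top](\<lambda>_. 1)"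
      "(\<lambda>t. 1 / p t) \<in> O[at_top](\<lambda>_. 1)"
      using bigo_1_of_bounds[of 0 0 "\<lambda>t. q t powr e" "u powr e"]
        bigo_1_of_bounds[of 0 0 "\<lambda>t. q t powr (e - 1)" "l powr (e - 1)"]
        bigo_1_of_bounds[of 0 0 "\<lambda>t. 1 / p t" "1 / l"] by simp_all
  qed
  note bd = landau_o.big.mult_in_1 sum_in_bigo bigo_const
  have Bo: "B \<in> O[at_top](\<lambda>_. 1)"
  proof -
    have "(\<lambda>t. (q t powr e - 1) * (1 / p t)) \<in> O[at_top](\<lambda>_. 1)" by (intro bd o1 o2)
    then show ?thesis by (simp add: B_def[abs_def])
  qed
  have B'o: "B' \<in> O[at_top](\<lambda>_. 1)"
  proof -
    have "(\<lambda>t. (e * q t powr (e - 1) * (\<gamma> * (\<phi> (exp t) * (1 / p t) - q t)) * p t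
      - (q t powr e - 1) * (\<beta> * (q t powr e - p t))) * ((1 / p t) * (1 / p t))) \<in> O[at_top](\<lambda>_. 1)"
      by (intro bd o1 o2)
    then show ?thesis by (simp add: B'_def[abs_def])
  qed
  have "(\<lambda>t. A t * (B t - B' t)) \<in> O[at_top](\<lambda>t. exp (- t) * 1)"
    by (intro landau_o.big.mult A_bigo sum_in_bigo Bo B'o)
  then obtain C1 where C1: "\<forall>\<^sub>F t in at_top. norm (A t * (B t - B' t)) \<le> C1 * norm (exp (- t) * 1)"
    by (elim landau_o.bigE)
  have "(\<lambda>t. A t * B t) \<in> O[at_top](\<lambda>t. exp (- t) * 1)"
    by (intro landau_o.big.mult A_bigo Bo)
  then obtain C2 where C2: "\<forall>\<^sub>F t in at_top. norm (A t * B t) \<le> C2 * norm (exp (- t) * 1)"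
    by (elim landau_o.bigE)
  have "\<forall>\<^sub>F t in at_top. t \<ge> 0 \<and> \<bar>A t * (B t - B' t)\<bar> \<le> C1 * exp (- t) \<and> \<bar>A t * B t\<bar> \<le> C2 * exp (- t)"
    using C1 C2 eventually_ge_at_top[of 0] by eventually_elim auto
  then obtain t0 where t0: "\<And>t. t \<ge> t0 \<Longrightarrow> t \<ge> 0"
     "\<And>t. t \<ge> t0 \<Longrightarrow> \<bar>A t * (B t - B' t)\<bar> \<le> C1 * exp (- t)"
     "\<And>t. t \<ge> t0 \<Longrightarrow> \<bar>A t * B t\<bar> \<le> C2 * exp (- t)"
    unfolding eventually_at_top_linorder by blast
  define W where "W t = V t - \<beta> * \<gamma> * (A t * B t)" for t
  \<comment> \<open>The cap \<open>1/2\<close> keeps the rate below that of the forcing \<open>e\<^sup>-\<^sup>t\<close>.\<close>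
  define c where "c = min (\<beta> * \<gamma> / (\<beta> + \<gamma>)) (1 / 2)"
  have c: "0 < c" "c < 1" using beta_pos gamma by (auto simp: c_def)
  have dW: "(W has_real_derivative - (\<beta> * \<gamma> * D t) + \<beta> * \<gamma> * (A t * (B t - B' t))) (at t)" for t
  proof -
    have "(W has_real_derivative - (\<beta> * \<gamma> * D t) + \<beta> * \<gamma> * (B t * (\<phi> (exp t) - 1))
       - \<beta> * \<gamma> * ((- A t + (\<phi> (exp t) - 1)) * B t + B' t * A t)) (at t)"
      unfolding W_def using dV[of t] by (intro DERIV_diff DERIV_cmult DERIV_mult dA dB) (simp add: B_def)
    then show ?thesis by (simp add: algebra_simps)
  qed
  define C where "C = \<beta> * \<gamma> * C1 + c * (\<beta> * \<gamma> * C2)"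
  have bg: "\<beta> * \<gamma> > 0" using beta_pos gamma by simp
  have W_near: "\<bar>W t - V t\<bar> \<le> \<beta> * \<gamma> * C2 * exp (- t)" if t: "t \<ge> t0" for t
    using mult_left_mono[OF t0(3)[OF t], of "\<beta> * \<gamma>"] bg beta_pos gamma
    by (simp add: W_def abs_mult mult_ac)
  have "- (\<beta> * \<gamma> * D t) + \<beta> * \<gamma> * (A t * (B t - B' t)) \<le> - c * W t + C * exp (- t)" if t: "t \<ge> t0" for t
  proof -
    have "c * V t \<le> \<beta> * \<gamma> / (\<beta> + \<gamma>) * V t"
      using V_ge(3)[OF t0(1)[OF t]] by (intro mult_right_mono) (auto simp: c_def)
    also have "\<dots> \<le> \<beta> * \<gamma> / (\<beta> + \<gamma>) * ((\<beta> + \<gamma>) * D t)"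
      using V_le_D beta_pos gamma by (intro mult_left_mono) auto
    also have "\<dots> = \<beta> * \<gamma> * D t" using beta_pos gamma by simp
    finally have 1: "c * V t \<le> \<beta> * \<gamma> * D t" .
    have 2: "\<beta> * \<gamma> * (A t * (B t - B' t)) \<le> \<beta> * \<gamma> * (C1 * exp (- t))"
      using t0(2)[OF t] bg by (intro mult_left_mono) auto
    have "W t \<le> V t + \<beta> * \<gamma> * C2 * exp (- t)" using W_near[OF t] by linarith
    then have "c * W t \<le> c * (V t + \<beta> * \<gamma> * C2 * exp (- t))" using c by (intro mult_left_mono) auto
    then have 3: "c * W t \<le> c * V t + c * (\<beta> * \<gamma> * C2) * exp (- t)" by (simp add: algebra_simps)
    show ?thesis using 1 2 3 unfolding C_def by (simp add: algebra_simps)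
  qed
  then obtain K where K: "\<And>t. t \<ge> t0 \<Longrightarrow> W t \<le> K * exp (- c * t)"
    using exponential_decay[OF c dW, of t0 C] by blast
  have V_decay: "V t \<le> (K + \<beta> * \<gamma> * \<bar>C2\<bar>) * exp (- (2 * (c / 2) * t))" if t: "t \<ge> t0" for t
  proof -
    have "exp (- t) \<le> exp (- (c * t))" using c t0(1)[OF t] by (simp add: mult_left_le_one_le)
    then have "C2 * exp (- t) \<le> \<bar>C2\<bar> * exp (- (c * t))" by (intro mult_mono) auto
    then have "\<beta> * \<gamma> * (C2 * exp (- t)) \<le> \<beta> * \<gamma> * (\<bar>C2\<bar> * exp (- (c * t)))"
      using bg by (intro mult_left_mono) auto
    then show ?thesis using K[OF t] W_near[OF t] by (simp add: algebra_simps)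
  qed
  show ?thesis
  proof (rule that[of "c / 2"])
    show "(\<lambda>t. p t - 1) \<in> O[at_top](\<lambda>t. exp (- (c / 2 * t)))"
      using V_decay V_ge(1)[OF t0(1)] by (rule bigo_sqrt_exp[OF a, rotated])
    show "(\<lambda>t. q t - 1) \<in> O[at_top](\<lambda>t. exp (- (c / 2 * t)))"
      using V_decay V_ge(2)[OF t0(1)] by (rule bigo_sqrt_exp[OF a, rotated])
  qed (use c in auto)
qed

text \<open>The equilibrium is approached at any rate \<open>\<mu> \<le> 2\<close> for which the linearisation can be put in the form
required by \<open>perturbed_oscillator_decay\<close>; \<open>2\<close> is a barrier in general, because the square of
\<open>A\<^sub>1\<close> has nonzero mean and shifts the solution by a multiple of \<open>e\<^sup>-\<^sup>2\<^sup>t\<close>. The condition on \<open>\<kappa>\<close> says that the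
characteristic polynomial of the linearisation is positive at \<open>-\<mu>\<close>.\<close>
lemma sharp_decay:
  assumes mu: "0 < \<mu>" "\<mu> \<le> 2" "2 * \<mu> \<le> \<beta> + \<gamma>"
    and kappa: "2 * e * \<beta> - (\<mu> - 2) * (\<beta> + \<gamma> - 2 - \<mu>) > 0"
  shows "(\<lambda>t. P t - 1) \<in> O[at_top](\<lambda>t. exp (- (\<mu> * t)))"
proof -
  obtain \<delta> where \<delta>: "0 < \<delta>" "\<delta> \<le> 1"
    and p_conv: "(\<lambda>t. p t - 1) \<in> O[at_top](\<lambda>t. exp (- (\<delta> * t)))"
    and q_conv: "(\<lambda>t. q t - 1) \<in> O[at_top](\<lambda>t. exp (- (\<delta> * t)))"
    using exponential_convergence by blast
  define n where "n = \<beta> + \<gamma>"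
  define E where "E t = exp (- (\<delta> * t))" for t
  have E1: "E \<in> O[at_top](\<lambda>_. 1)" unfolding E_def using \<delta> by real_asymp
  have EE: "(\<lambda>t. f t * h t) \<in> O[at_top](E)" if "f \<in> O[at_top](E)" "h \<in> O[at_top](E)" for f h
    using landau_o.big.mult[OF that(1) landau_o.big_trans[OF that(2) E1]] by simp
  \<comment> \<open>Iterated primitives: \<open>A\<^sub>j\<close> below has size \<open>e\<^sup>-\<^sup>j\<^sup>t\<close> and \<open>A\<^sub>j' = -j A\<^sub>j + A\<^sub>j\<^sub>-\<^sub>1\<close>.\<close>
  obtain H1 where H1: "zero_mean_on_period T H1" "\<forall>r>0. (H1 has_real_derivative \<phi> r - 1) (at r)"
    using zero_mean_on_period_primitive[OF T zero_mean_phi] by blast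
  obtain H2 where H2: "zero_mean_on_period T H2" "\<forall>r>0. (H2 has_real_derivative H1 r) (at r)"
    using zero_mean_on_period_primitive[OF T H1(1)] by blast
  obtain H3 where H3: "zero_mean_on_period T H3" "\<forall>r>0. (H3 has_real_derivative H2 r) (at r)"
    using zero_mean_on_period_primitive[OF T H2(1)] by blast
  \<comment> \<open>\<open>A\<^sub>1\<^sup>2\<close> splits into \<open>m\<^sub>2 e\<^sup>-\<^sup>2\<^sup>t\<close> and an oscillating part, to which the same device applies.\<close>
  define m2 where "m2 = integral {0..T} (\<lambda>r. (H1 r)\<^sup>2) / T"
  have "zero_mean_on_period T (\<lambda>r. (H1 r)\<^sup>2 - m2)"
  proof -
    have c: "continuous_on {0..} H1" and per: "\<forall>r\<ge>0. H1 (r + T) = H1 r"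
      using H1(1) by (auto simp: zero_mean_on_period_def)
    have "continuous_on {0..T} H1" using c continuous_on_subset by fastforce
    then have "integral {0..T} (\<lambda>r. (H1 r)\<^sup>2 - m2) = 0"
      using T by (subst integral_diff) (auto intro!: integrable_continuous_real continuous_intros simp: m2_def)
    then show ?thesis unfolding zero_mean_on_period_def using c per by (auto intro!: continuous_intros)
  qed
  then obtain H4 where H4: "zero_mean_on_period T H4" "\<forall>r>0. (H4 has_real_derivative (H1 r)\<^sup>2 - m2) (at r)"
    using zero_mean_on_period_primitive[OF T] by blast
  define A1 where "A1 t = exp (- t) * H1 (exp t)" for t
  define A2 where "A2 t = exp (- (2 * t)) * H2 (exp t)" for t
  define A3 where "A3 t = exp (- (3 * t)) * H3 (exp t)" for t
  define B3 where "B3 t = exp (- (3 * t)) * H4 (exp t)" for t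
  have dA1: "(A1 has_real_derivative (- A1 t + (\<phi> (exp t) - 1))) (at t)" for t
    using deriv_decaying_periodic[OF H1(2), of 1 t] by (simp add: A1_def[abs_def])
  have dA2: "(A2 has_real_derivative (- 2 * A2 t + A1 t)) (at t)" for t
    using deriv_decaying_periodic[OF H2(2), of 2 t] by (simp add: A2_def[abs_def] A1_def)
  have dA3: "(A3 has_real_derivative (- 3 * A3 t + A2 t)) (at t)" for t
    using deriv_decaying_periodic[OF H3(2), of 3 t] by (simp add: A3_def[abs_def] A2_def)
  have A1sq: "exp (- (2 * t)) * ((H1 (exp t))\<^sup>2 - m2) = (A1 t)\<^sup>2 - m2 * exp (- (2 * t))" for t
  proof -
    have "exp (- (2 * t)) = exp (- t) * exp (- t)" by (simp flip: exp_add)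
    then show ?thesis by (simp add: A1_def power_mult_distrib power2_eq_square algebra_simps)
  qed
  have dB3: "(B3 has_real_derivative (- 3 * B3 t + ((A1 t)\<^sup>2 - m2 * exp (- (2 * t))))) (at t)" for t
    using deriv_decaying_periodic[OF H4(2), of 3 t] by (simp add: B3_def[abs_def] A1sq)
  have A1o: "A1 \<in> O[at_top](\<lambda>t. exp (- t))"
    using bigo_decaying_periodic[OF T H1(1), of 1] by (simp add: A1_def[abs_def])
  have A2o: "A2 \<in> O[at_top](\<lambda>t. exp (- (2 * t)))"
    using bigo_decaying_periodic[OF T H2(1), of 2] by (simp add: A2_def[abs_def])
  have A3o: "A3 \<in> O[at_top](\<lambda>t. exp (- (3 * t)))"
    using bigo_decaying_periodic[OF T H3(1), of 3] by (simp add: A3_def[abs_def])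
  have B3o: "B3 \<in> O[at_top](\<lambda>t. exp (- (3 * t)))"
    using bigo_decaying_periodic[OF T H4(1), of 3] by (simp add: B3_def[abs_def])
  have A1E: "A1 \<in> O[at_top](E)"
  proof -
    have "(\<lambda>t::real. exp (- t)) \<in> O[at_top](E)"
    proof (rule bigoI[of _ 1])
      show "\<forall>\<^sub>F t::real in at_top. norm (exp (- t)) \<le> 1 * norm (E t)"
        using eventually_ge_at_top[of 0]
        by eventually_elim (use \<delta> in \<open>auto simp: E_def mult_left_le_one_le\<close>)
    qed
    with A1o show ?thesis by (rule landau_o.big_trans)
  qed

  \<comment> \<open>Subtracting \<open>\<gamma> A\<^sub>1\<close> from \<open>Z - 1\<close> takes the bounded forcing out of the equation of \<open>Z\<close>.\<close>
  define X where "X t = P t - 1" for t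
  define z where "z t = Z t - 1" for t
  define Y where "Y t = z t - \<gamma> * A1 t" for t
  have pE: "(\<lambda>t. p t - 1) \<in> O[at_top](E)" and qE: "(\<lambda>t. q t - 1) \<in> O[at_top](E)"
    using p_conv q_conv by (simp_all add: E_def[abs_def])
  have XE: "X \<in> O[at_top](E)"
  proof -
    have "(\<lambda>t. (1 + (p t - 1)) powr (1 + e) - 1) \<in> O[at_top](\<lambda>t. p t - 1)"
      by (rule landau_o.big.compose[OF powr_expansion_1 decaying_tendsto_0[OF p_conv \<delta>(1)]])
    then show ?thesis using pE by (auto simp: X_def[abs_def] P_def intro: landau_o.big_trans)
  qed
  have zE: "z \<in> O[at_top](E)"
  proof -
    have "(\<lambda>t. (p t - 1) * (q t - 1) + (p t - 1) + (q t - 1)) \<in> O[at_top](E)"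
      by (intro sum_in_bigo EE pE qE)
    then show ?thesis by (simp add: z_def[abs_def] Z_def algebra_simps)
  qed
  have z0: "filterlim z (nhds 0) at_top"
    using decaying_tendsto_0[OF _ \<delta>(1)] zE by (simp add: E_def[abs_def])
  have cE: "(\<lambda>t. c * f t) \<in> O[at_top](E)" if "f \<in> O[at_top](E)" for f c using that by simp
  have YE: "Y \<in> O[at_top](E)" unfolding Y_def by (intro sum_in_bigo zE cE A1E)
  \<comment> \<open>The error class: terms containing \<open>X\<close> or \<open>Y\<close> with a decaying factor, and terms of third order in \<open>e\<^sup>-\<^sup>t\<close>.\<close>
  define g where "g t = E t * (\<bar>X t\<bar> + \<bar>Y t\<bar>) + exp (- (3 * t))" for t
  have gX: "(\<lambda>t. f t * X t) \<in> O[at_top](g)" if "f \<in> O[at_top](E)" for f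
    by (rule bigo_absorb_times[OF that], rule bigoI[of _ 1]) (auto simp: g_def E_def algebra_simps)
  have gY: "(\<lambda>t. f t * Y t) \<in> O[at_top](g)" if "f \<in> O[at_top](E)" for f
    by (rule bigo_absorb_times[OF that], rule bigoI[of _ 1]) (auto simp: g_def E_def algebra_simps)
  have g3: "f \<in> O[at_top](g)" if "f \<in> O[at_top](\<lambda>t. exp (- (3 * t)))" for f
    by (rule landau_o.big_trans[OF that], rule bigoI[of _ 1]) (auto simp: g_def E_def)
  have cg: "(\<lambda>t. c * f t) \<in> O[at_top](g)" if "f \<in> O[at_top](g)" for f c using that by simp
  have zY: "z t = Y t + \<gamma> * A1 t" for t by (simp add: Y_def)
  have zz: "(\<lambda>t. (z t)\<^sup>2 - \<gamma>\<^sup>2 * (A1 t)\<^sup>2) \<in> O[at_top](g)"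
  proof -
    have "(\<lambda>t. (Y t + 2 * \<gamma> * A1 t) * Y t) \<in> O[at_top](g)"
      by (intro gY sum_in_bigo YE cE A1E)
    then show ?thesis by (simp add: zY power2_eq_square algebra_simps)
  qed
  have zzz: "(\<lambda>t. (z t) ^ 3) \<in> O[at_top](g)"
  proof -
    have "(\<lambda>t. A1 t * A1 t * A1 t) \<in> O[at_top](\<lambda>t. exp (- t) * exp (- t) * exp (- t))"
      by (intro landau_o.big.mult A1o)
    then have "(\<lambda>t. A1 t * A1 t * A1 t) \<in> O[at_top](g)" by (intro g3) (simp add: exp_add[symmetric])
    then have "(\<lambda>t. (z t * z t + \<gamma> * (A1 t * z t) + \<gamma>\<^sup>2 * (A1 t * A1 t)) * Y t
       + \<gamma> ^ 3 * (A1 t * A1 t * A1 t)) \<in> O[at_top](g)"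
      by (intro sum_in_bigo gY EE zE A1E cE) simp_all
    then show ?thesis by (simp add: zY power2_eq_square power3_eq_cube algebra_simps)
  qed
  have taylor: "(\<lambda>t. Z t powr a - 1 - a * z t - a * (a - 1) / 2 * \<gamma>\<^sup>2 * (A1 t)\<^sup>2) \<in> O[at_top](g)" for a
  proof -
    have "(\<lambda>t. (1 + z t) powr a - 1 - a * z t - a * (a - 1) / 2 * (z t) ^ 2) \<in> O[at_top](\<lambda>t. z t ^ 3)"
      by (rule landau_o.big.compose[OF powr_expansion_3 z0])
    then have "(\<lambda>t. (1 + z t) powr a - 1 - a * z t - a * (a - 1) / 2 * (z t) ^ 2) \<in> O[at_top](g)"
      using zzz by (rule landau_o.big_trans)
    moreover have "(\<lambda>t. a * (a - 1) / 2 * ((z t)\<^sup>2 - \<gamma>\<^sup>2 * (A1 t)\<^sup>2)) \<in> O[at_top](g)"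
      using zz by simp
    ultimately have "(\<lambda>t. ((1 + z t) powr a - 1 - a * z t - a * (a - 1) / 2 * (z t) ^ 2) +
       a * (a - 1) / 2 * ((z t)\<^sup>2 - \<gamma>\<^sup>2 * (A1 t)\<^sup>2)) \<in> O[at_top](g)" by (rule sum_in_bigo)
    then show ?thesis by (simp add: z_def algebra_simps)
  qed
  \<comment> \<open>Nonlinear parts. Modulo the error class only their terms in \<open>A\<^sub>1\<^sup>2\<close> survive.\<close>
  define N1 where "N1 t = 2 * (Z t powr e - 1 - e * z t)" for t
  define N2 where "N2 t = \<beta> * (Z t powr (1 + e) / P t - 1 - (1 + e) * z t + X t)" for t
  define b1 where "b1 = e * (e - 1) * \<gamma>\<^sup>2"
  define b2 where "b2 = e * \<gamma>\<^sup>2"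
  have N1: "(\<lambda>t. N1 t - b1 * (A1 t)\<^sup>2) \<in> O[at_top](g)"
  proof -
    have "N1 t - b1 * (A1 t)\<^sup>2 = 2 * (Z t powr e - 1 - e * z t - e * (e - 1) / 2 * \<gamma>\<^sup>2 * (A1 t)\<^sup>2)" for t
      by (simp add: N1_def b1_def)
    then show ?thesis using cg[OF taylor[of e], of 2] by simp
  qed
  have N2: "(\<lambda>t. N2 t - b2 * (A1 t)\<^sup>2) \<in> O[at_top](g)"
  proof -
    have ZaE: "(\<lambda>t. Z t powr (1 + e) - 1) \<in> O[at_top](E)"
    proof -
      have "(\<lambda>t. (1 + z t) powr (1 + e) - 1) \<in> O[at_top](z)"
        by (rule landau_o.big.compose[OF powr_expansion_1 z0])
      then show ?thesis using zE by (auto simp: z_def intro: landau_o.big_trans)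
    qed
    have ZaP: "(\<lambda>t. Z t powr (1 + e) / P t) \<in> O[at_top](\<lambda>_. 1)"
    proof -
      have "((\<lambda>t. (1 + z t) powr (1 + e) / (1 + X t)) \<longlongrightarrow> (1 + 0) powr (1 + e) / (1 + 0)) at_top"
        using decaying_tendsto_0[OF _ \<delta>(1)] XE by (intro tendsto_intros z0) (simp_all add: E_def[abs_def])
      then have "((\<lambda>t. Z t powr (1 + e) / P t) \<longlongrightarrow> 1) at_top" by (simp add: z_def X_def)
      then show ?thesis by (intro bigoI_tendsto[where c = 1]) auto
    qed
    have XZ: "(\<lambda>t. X t * (Z t powr (1 + e) / P t)) \<in> O[at_top](E)"
      using landau_o.big.mult[OF XE ZaP] by simp
    have "(\<lambda>t. \<beta> * ((Z t powr (1 + e) - 1 - (1 + e) * z t - (1 + e) * (1 + e - 1) / 2 * \<gamma>\<^sup>2 * (A1 t)\<^sup>2)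
        - (Z t powr (1 + e) - 1) * X t + (X t * (Z t powr (1 + e) / P t)) * X t)) \<in> O[at_top](g)"
      by (intro cg sum_in_bigo taylor gX ZaE XZ)
    moreover have "\<beta> * ((Z t powr (1 + e) - 1 - (1 + e) * z t - (1 + e) * (1 + e - 1) / 2 * \<gamma>\<^sup>2 * (A1 t)\<^sup>2)
        - (Z t powr (1 + e) - 1) * X t + (X t * (Z t powr (1 + e) / P t)) * X t) = N2 t - b2 * (A1 t)\<^sup>2" for t
    proof -
      have "Z t powr (1 + e) / P t = Z t powr (1 + e) - Z t powr (1 + e) * X t + (X t * (Z t powr (1 + e) / P t)) * X t"
        using P_pos[of t] by (simp add: X_def field_simps)
      moreover have "\<beta> * ((1 + w) * (1 + w - 1) / 2 * \<gamma>\<^sup>2 * (A1 t)\<^sup>2) = (\<beta> * (1 + w)) * (w * \<gamma>\<^sup>2 * (A1 t)\<^sup>2 / 2)"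
        for w by (simp add: field_simps)
      from this[of e] have "\<beta> * ((1 + e) * (1 + e - 1) / 2 * \<gamma>\<^sup>2 * (A1 t)\<^sup>2) = b2 * (A1 t)\<^sup>2"
        unfolding beta_e b2_def by simp
      moreover have "\<beta> * ((a - 1 - d - c) - (a - 1) * x + (x * W) * x) = \<beta> * (W - 1 - d + x) - b"
        if "W = a - a * x + (x * W) * x" "\<beta> * c = b" for a W x d c b :: real
      proof -
        have "(a - 1 - d - c) - (a - 1) * x + (x * W) * x = (W - 1 - d + x) - c"
          using that(1) by (simp add: algebra_simps)
        then show ?thesis using that(2) by (simp only: right_diff_distrib)
      qed
      ultimately show ?thesis unfolding N2_def by blast
    qed
    ultimately show ?thesis by (simp only:)
  qed
  have dX: "(X has_real_derivative (- 2 * X t + 2 * e * (Y t + \<gamma> * A1 t) + N1 t)) (at t)" for t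
    unfolding X_def using dP[of t]
    by (auto intro!: derivative_eq_intros simp: N1_def X_def Y_def algebra_simps)
  have dY: "(Y has_real_derivative (- \<beta> * X t + (2 - n) * Y t + (3 - n) * \<gamma> * A1 t + N2 t)) (at t)" for t
  proof -
    have "(Y has_real_derivative (\<gamma> * \<phi> (exp t) - (\<beta> + \<gamma>) * Z t + \<beta> * (Z t powr (1 + e) / P t)
       - \<gamma> * (- A1 t + (\<phi> (exp t) - 1)))) (at t)"
      unfolding Y_def z_def using dZ[of t] dA1[of t] by (auto intro!: derivative_eq_intros)
    moreover have "\<beta> * (Z t powr (1 + e) / P t) = N2 t + \<beta> + (\<beta> * (1 + e)) * z t - \<beta> * X t"
      by (simp add: N2_def algebra_simps)
    then have W: "\<beta> * (Z t powr (1 + e) / P t) = N2 t + \<beta> + 2 * z t - \<beta> * X t" by (simp only: beta_e)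
    have "\<gamma> * \<phi> (exp t) - (\<beta> + \<gamma>) * Z t + \<beta> * (Z t powr (1 + e) / P t) - \<gamma> * (- A1 t + (\<phi> (exp t) - 1))
      = - \<beta> * X t + (2 - n) * Y t + (3 - n) * \<gamma> * A1 t + N2 t"
      unfolding W n_def Y_def z_def by (simp add: algebra_simps)
    ultimately show ?thesis by simp
  qed

  \<comment> \<open>The coordinate \<open>S\<close> is chosen so that the linear part of the first equation is \<open>-\<mu> X + S\<close>; that of the
    second is then \<open>-\<kappa> X - \<nu> S\<close>, by trace and determinant.\<close>
  define \<nu> where "\<nu> = n - \<mu>"
  define \<kappa> where "\<kappa> = 2 * e * \<beta> - (\<mu> - 2) * (n - 2 - \<mu>)"
  define S where "S t = 2 * e * Y t + (\<mu> - 2) * X t" for t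
  define a1 where "a1 = 2 * e * \<gamma>"
  define a2 where "a2 = 2 * e * (3 - n) * \<gamma> + (\<mu> - 2) * a1"
  define c2 where "c2 = 2 * e * b2 + (\<mu> - 2) * b1"
  \<comment> \<open>With \<open>L\<close> the linear part, \<open>g = (L + 2) a\<close> compensates the defect of \<open>a A\<^sub>2\<close>, and \<open>d\<close> solves
    \<open>(L + 2) d = - m\<^sub>2 (b\<^sub>1, c\<^sub>2)\<close>. This is possible as \<open>-2\<close> is never an eigenvalue: \<open>det (L + 2) = \<Delta> > 0\<close>.\<close>
  define g1 where "g1 = (2 - \<mu>) * a1 + a2"
  define g2 where "g2 = - \<kappa> * a1 + (2 - \<nu>) * a2"
  define \<Delta> where "\<Delta> = (2 - \<mu>) * (2 - \<nu>) + \<kappa>"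
  have Delta: "\<Delta> > 0"
  proof -
    have "\<Delta> = 2 * e * \<beta>" by (simp add: \<Delta>_def \<kappa>_def \<nu>_def algebra_simps)
    then show ?thesis using e beta_pos by simp
  qed
  define d1 where "d1 = (m2 * c2 - m2 * b1 * (2 - \<nu>)) / \<Delta>"
  define d2 where "d2 = (- m2 * c2 * (2 - \<mu>) - \<kappa> * m2 * b1) / \<Delta>"
  have d: "(2 - \<mu>) * d1 + d2 = - m2 * b1" "- \<kappa> * d1 + (2 - \<nu>) * d2 = - m2 * c2"
  proof -
    have "\<Delta> * ((2 - \<mu>) * d1 + d2) = (2 - \<mu>) * (\<Delta> * d1) + \<Delta> * d2" by (simp add: algebra_simps)
    also have "\<dots> = (2 - \<mu>) * (m2 * c2 - m2 * b1 * (2 - \<nu>)) + (- m2 * c2 * (2 - \<mu>) - \<kappa> * m2 * b1)"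
      using Delta by (simp add: d1_def d2_def)
    also have "\<dots> = \<Delta> * (- m2 * b1)" by (simp add: \<Delta>_def algebra_simps)
    finally show "(2 - \<mu>) * d1 + d2 = - m2 * b1" by (simp only: mult_left_cancel[OF Delta[THEN less_imp_neq, symmetric]])
    have "\<Delta> * (- \<kappa> * d1 + (2 - \<nu>) * d2) = - \<kappa> * (\<Delta> * d1) + (2 - \<nu>) * (\<Delta> * d2)" by (simp add: algebra_simps)
    also have "\<dots> = - \<kappa> * (m2 * c2 - m2 * b1 * (2 - \<nu>)) + (2 - \<nu>) * (- m2 * c2 * (2 - \<mu>) - \<kappa> * m2 * b1)"
      using Delta by (simp add: d1_def d2_def)
    also have "\<dots> = \<Delta> * (- m2 * c2)" by (simp add: \<Delta>_def algebra_simps)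
    finally show "- \<kappa> * d1 + (2 - \<nu>) * d2 = - m2 * c2" by (simp only: mult_left_cancel[OF Delta[THEN less_imp_neq, symmetric]])
  qed
  \<comment> \<open>The corrector \<open>\<xi>\<close> satisfies \<open>\<xi>' = L \<xi> + a A\<^sub>1 + (b\<^sub>1, c\<^sub>2) A\<^sub>1\<^sup>2\<close> up to \<open>O(e\<^sup>-\<^sup>3\<^sup>t)\<close>.\<close>
  define \<xi>1 where "\<xi>1 t = a1 * A2 t + d1 * exp (- (2 * t)) + g1 * A3 t + b1 * B3 t" for t
  define \<xi>2 where "\<xi>2 t = a2 * A2 t + d2 * exp (- (2 * t)) + g2 * A3 t + c2 * B3 t" for t
  define r1 where "r1 t = (- 3 * g1 + \<mu> * g1 - g2) * A3 t + (- 3 * b1 + \<mu> * b1 - c2) * B3 t" for t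
  define r2 where "r2 t = (- 3 * g2 + \<kappa> * g1 + \<nu> * g2) * A3 t + (- 3 * c2 + \<kappa> * b1 + \<nu> * c2) * B3 t" for t
  have d\<xi>1: "(\<xi>1 has_real_derivative (- \<mu> * \<xi>1 t + \<xi>2 t + a1 * A1 t + b1 * (A1 t)\<^sup>2 + r1 t)) (at t)" for t
  proof -
    have "(\<xi>1 has_real_derivative (a1 * (- 2 * A2 t + A1 t) - 2 * d1 * exp (- (2 * t))
      + g1 * (- 3 * A3 t + A2 t) + b1 * (- 3 * B3 t + ((A1 t)\<^sup>2 - m2 * exp (- (2 * t)))))) (at t)"
      unfolding \<xi>1_def using dA2[of t] dA3[of t] dB3[of t] by (auto intro!: derivative_eq_intros)
    moreover have "a1 * (- 2 * A2 t + A1 t) - 2 * d1 * exp (- (2 * t))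
      + g1 * (- 3 * A3 t + A2 t) + b1 * (- 3 * B3 t + ((A1 t)\<^sup>2 - m2 * exp (- (2 * t))))
      = - \<mu> * \<xi>1 t + \<xi>2 t + a1 * A1 t + b1 * (A1 t)\<^sup>2 + r1 t"
      using d(1) unfolding \<xi>1_def \<xi>2_def r1_def g1_def by algebra
    ultimately show ?thesis by simp
  qed
  have d\<xi>2: "(\<xi>2 has_real_derivative (- \<kappa> * \<xi>1 t - \<nu> * \<xi>2 t + a2 * A1 t + c2 * (A1 t)\<^sup>2 + r2 t)) (at t)" for t
  proof -
    have "(\<xi>2 has_real_derivative (a2 * (- 2 * A2 t + A1 t) - 2 * d2 * exp (- (2 * t))
      + g2 * (- 3 * A3 t + A2 t) + c2 * (- 3 * B3 t + ((A1 t)\<^sup>2 - m2 * exp (- (2 * t)))))) (at t)"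
      unfolding \<xi>2_def using dA2[of t] dA3[of t] dB3[of t] by (auto intro!: derivative_eq_intros)
    moreover have "a2 * (- 2 * A2 t + A1 t) - 2 * d2 * exp (- (2 * t))
      + g2 * (- 3 * A3 t + A2 t) + c2 * (- 3 * B3 t + ((A1 t)\<^sup>2 - m2 * exp (- (2 * t))))
      = - \<kappa> * \<xi>1 t - \<nu> * \<xi>2 t + a2 * A1 t + c2 * (A1 t)\<^sup>2 + r2 t"
      using d(2) unfolding \<xi>1_def \<xi>2_def r2_def g2_def by algebra
    ultimately show ?thesis by simp
  qed
  have \<xi>o: "\<xi>1 \<in> O[at_top](\<lambda>t. exp (- (2 * t)))" "\<xi>2 \<in> O[at_top](\<lambda>t. exp (- (2 * t)))"
  proof -
    have 32: "(\<lambda>t::real. exp (- (3 * t))) \<in> O[at_top](\<lambda>t. exp (- (2 * t)))" by real_asymp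
    have c: "(\<lambda>t. c * f t) \<in> O[at_top](\<lambda>t. exp (- (2 * t)))" if "f \<in> O[at_top](\<lambda>t. exp (- (2 * t)))" for f c
      using that by simp
    show "\<xi>1 \<in> O[at_top](\<lambda>t. exp (- (2 * t)))" "\<xi>2 \<in> O[at_top](\<lambda>t. exp (- (2 * t)))"
      unfolding \<xi>1_def \<xi>2_def
      by (intro sum_in_bigo c A2o landau_o.big_refl landau_o.big_trans[OF A3o 32] landau_o.big_trans[OF B3o 32])+
  qed
  have ro: "r1 \<in> O[at_top](g)" "r2 \<in> O[at_top](g)"
    unfolding r1_def r2_def by (intro sum_in_bigo cg g3 A3o B3o)+
  define x where "x t = X t - \<xi>1 t" for t
  define s where "s t = S t - \<xi>2 t" for t
  define e1 where "e1 t = (N1 t - b1 * (A1 t)\<^sup>2) - r1 t" for t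
  define e2 where "e2 t = 2 * e * (N2 t - b2 * (A1 t)\<^sup>2) + (\<mu> - 2) * (N1 t - b1 * (A1 t)\<^sup>2) - r2 t" for t
  have eo: "e1 \<in> O[at_top](g)" "e2 \<in> O[at_top](g)"
    unfolding e1_def e2_def by (intro sum_in_bigo cg N1 N2 ro)+
  have dx: "(x has_real_derivative - \<mu> * x t + s t + e1 t) (at t)" for t
  proof -
    have "(x has_real_derivative (- 2 * X t + 2 * e * (Y t + \<gamma> * A1 t) + N1 t)
       - (- \<mu> * \<xi>1 t + \<xi>2 t + a1 * A1 t + b1 * (A1 t)\<^sup>2 + r1 t)) (at t)"
      unfolding x_def by (intro DERIV_diff dX d\<xi>1)
    then show ?thesis by (simp add: x_def s_def S_def e1_def a1_def algebra_simps)
  qed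
  have ds: "(s has_real_derivative - \<kappa> * x t - \<nu> * s t + e2 t) (at t)" for t
  proof -
    have "(s has_real_derivative 2 * e * (- \<beta> * X t + (2 - n) * Y t + (3 - n) * \<gamma> * A1 t + N2 t)
       + (\<mu> - 2) * (- 2 * X t + 2 * e * (Y t + \<gamma> * A1 t) + N1 t)
       - (- \<kappa> * \<xi>1 t - \<nu> * \<xi>2 t + a2 * A1 t + c2 * (A1 t)\<^sup>2 + r2 t)) (at t)"
      unfolding s_def S_def by (intro DERIV_diff DERIV_add DERIV_cmult dX dY d\<xi>2)
    moreover have "2 * e * (- \<beta> * X t + (2 - n) * Y t + (3 - n) * \<gamma> * A1 t + N2 t)
       + (\<mu> - 2) * (- 2 * X t + 2 * e * (Y t + \<gamma> * A1 t) + N1 t)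
       - (- \<kappa> * \<xi>1 t - \<nu> * \<xi>2 t + a2 * A1 t + c2 * (A1 t)\<^sup>2 + r2 t) = - \<kappa> * x t - \<nu> * s t + e2 t"
    proof -
      define w where "w = e"
      show ?thesis
        unfolding x_def s_def S_def e2_def c2_def a2_def a1_def \<kappa>_def \<nu>_def w_def[symmetric]
        by algebra
    qed
    ultimately show ?thesis by simp
  qed
  \<comment> \<open>The error class expressed in \<open>x\<close> and \<open>s\<close>: as \<open>\<xi> = O(e\<^sup>-\<^sup>2\<^sup>t)\<close> and \<open>\<mu> \<le> 2\<close>, it only adds terms of size \<open>e\<^sup>-\<^sup>(\<^sup>\<mu>\<^sup>+\<^sup>\<delta>\<^sup>)\<^sup>t\<close>.\<close>
  define G where "G t = exp (- (\<delta> * t)) * (\<bar>x t\<bar> + \<bar>s t\<bar>) + exp (- ((\<mu> + \<delta>) * t))" for t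
  have gG: "g \<in> O[at_top](G)"
  proof -
    have Gx: "(\<lambda>t. E t * \<bar>f t\<bar>) \<in> O[at_top](G)" if "\<And>t. f t = x t \<or> f t = s t" for f
    proof (rule bigoI[of _ 1], rule always_eventually, rule allI)
      fix t show "norm (E t * \<bar>f t\<bar>) \<le> 1 * norm (G t)"
        using that[of t] by (auto simp: G_def E_def distrib_left abs_mult)
    qed
    have Ge: "(\<lambda>t. exp (- ((\<mu> + \<delta>) * t))) \<in> O[at_top](G)"
      by (rule bigoI[of _ 1]) (auto simp: G_def)
    have G\<xi>: "(\<lambda>t. E t * f t) \<in> O[at_top](G)" if "f \<in> O[at_top](\<lambda>t. exp (- (2 * t)))" for f
    proof -
      have "(\<lambda>t. E t * f t) \<in> O[at_top](\<lambda>t. E t * exp (- (2 * t)))" using that by simp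
      also have "(\<lambda>t. E t * exp (- (2 * t))) \<in> O[at_top](\<lambda>t. exp (- ((\<mu> + \<delta>) * t)))"
      proof (rule bigoI[of _ 1])
        show "\<forall>\<^sub>F t in at_top. norm (E t * exp (- (2 * t))) \<le> 1 * norm (exp (- ((\<mu> + \<delta>) * t)))"
          using eventually_ge_at_top[of 0]
          by eventually_elim (use mu in \<open>auto simp: E_def distrib_right mult_right_mono simp flip: exp_add\<close>)
      qed
      also note Ge
      finally show ?thesis .
    qed
    have absE: "(\<lambda>t. E t * \<bar>f t\<bar>) \<in> O[at_top](G) \<longleftrightarrow> (\<lambda>t. E t * f t) \<in> O[at_top](G)" for f
      using landau_o.big.norm_iff[of "\<lambda>t. E t * f t" at_top G]
        landau_o.big.norm_iff[of "\<lambda>t. E t * \<bar>f t\<bar>" at_top G] by (simp add: abs_mult)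
    have "(\<lambda>t. E t * x t + E t * \<xi>1 t) \<in> O[at_top](G)"
      using absE[of x] Gx[of x] by (intro sum_in_bigo G\<xi>[OF \<xi>o(1)]) auto
    then have EX: "(\<lambda>t. E t * X t) \<in> O[at_top](G)" by (simp add: x_def algebra_simps)
    have "(\<lambda>t. E t * s t + E t * \<xi>2 t) \<in> O[at_top](G)"
      using absE[of s] Gx[of s] by (intro sum_in_bigo G\<xi>[OF \<xi>o(2)]) auto
    then have ES: "(\<lambda>t. E t * S t) \<in> O[at_top](G)" by (simp add: s_def algebra_simps)
    have "(\<lambda>t. 1 / (2 * e) * (E t * S t) - (\<mu> - 2) / (2 * e) * (E t * X t)) \<in> O[at_top](G)"
    proof -
      have c: "(\<lambda>t. c * f t) \<in> O[at_top](G)" if "f \<in> O[at_top](G)" for f c using that by simp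
      show ?thesis by (intro sum_in_bigo c ES EX)
    qed
    moreover have "1 / (2 * w) * (E t * (2 * w * Y t + (\<mu> - 2) * X t)) - (\<mu> - 2) / (2 * w) * (E t * X t)
      = E t * Y t" if "w > 0" for w t using that by (simp add: field_simps)
    note this[OF e(1)]
    ultimately have EY: "(\<lambda>t. E t * Y t) \<in> O[at_top](G)" unfolding S_def by (simp only:)
    have e3: "(\<lambda>t. exp (- (3 * t))) \<in> O[at_top](G)"
    proof -
      have "(\<lambda>t. exp (- (3 * t))) \<in> O[at_top](\<lambda>t. exp (- ((\<mu> + \<delta>) * t)))"
      proof (rule bigoI[of _ 1])
        show "\<forall>\<^sub>F t in at_top. norm (exp (- (3 * t))) \<le> 1 * norm (exp (- ((\<mu> + \<delta>) * t)))"
          using eventually_ge_at_top[of 0]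
          by eventually_elim (use mu \<delta> in \<open>auto intro!: mult_right_mono\<close>)
      qed
      then show ?thesis using Ge by (rule landau_o.big_trans)
    qed
    have "(\<lambda>t. E t * \<bar>X t\<bar> + E t * \<bar>Y t\<bar> + exp (- (3 * t))) \<in> O[at_top](G)"
      using EX EY by (intro sum_in_bigo e3) (simp_all only: absE)
    then show ?thesis by (simp add: g_def[abs_def] distrib_left)
  qed
  obtain C1 where C1: "\<forall>\<^sub>F t in at_top. norm (e1 t) \<le> C1 * norm (G t)"
    using landau_o.big_trans[OF eo(1) gG] by (elim landau_o.bigE)
  obtain C2 where C2: "\<forall>\<^sub>F t in at_top. norm (e2 t) \<le> C2 * norm (G t)"
    using landau_o.big_trans[OF eo(2) gG] by (elim landau_o.bigE)
  have Gpos: "norm (G t) = exp (- \<delta> * t) * (\<bar>x t\<bar> + \<bar>s t\<bar>) + exp (- (\<mu> + \<delta>) * t)" "G t \<ge> 0" for t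
    by (simp_all add: G_def algebra_simps)
  have "\<forall>\<^sub>F t in at_top. \<bar>e1 t\<bar> \<le> max C1 C2 * norm (G t) \<and> \<bar>e2 t\<bar> \<le> max C1 C2 * norm (G t)"
    using C1 C2
  proof eventually_elim
    case (elim t)
    have "C1 * norm (G t) \<le> max C1 C2 * norm (G t)" "C2 * norm (G t) \<le> max C1 C2 * norm (G t)"
      by (intro mult_right_mono; simp)+
    then show ?case using elim by auto
  qed
  then obtain t0 where t0: "\<And>t. t \<ge> t0 \<Longrightarrow> \<bar>e1 t\<bar> \<le> max C1 C2 * norm (G t)"
    "\<And>t. t \<ge> t0 \<Longrightarrow> \<bar>e2 t\<bar> \<le> max C1 C2 * norm (G t)"
    unfolding eventually_at_top_linorder by blast
  have munu: "\<mu> \<le> \<nu>" using mu by (simp add: \<nu>_def n_def)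
  have kap: "\<kappa> > 0" using kappa by (simp add: \<kappa>_def n_def)
  obtain B where B: "\<And>t. t \<ge> t0 \<Longrightarrow> \<bar>x t\<bar> \<le> B * exp (- \<mu> * t)"
    using perturbed_oscillator_decay[OF munu kap \<delta>(1) dx ds t0[unfolded Gpos(1)]] by blast
  have "x \<in> O[at_top](\<lambda>t. exp (- (\<mu> * t)))"
    by (rule bigoI[of _ B]) (use B in \<open>auto intro: eventually_mono[OF eventually_ge_at_top[of t0]]\<close>)
  moreover have "\<xi>1 \<in> O[at_top](\<lambda>t. exp (- (\<mu> * t)))"
  proof -
    have "(\<lambda>t. exp (- (2 * t))) \<in> O[at_top](\<lambda>t. exp (- (\<mu> * t)))"
    proof (rule bigoI[of _ 1])
      show "\<forall>\<^sub>F t in at_top. norm (exp (- (2 * t))) \<le> 1 * norm (exp (- (\<mu> * t)))"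
        using eventually_ge_at_top[of 0]
        by eventually_elim (use mu in \<open>auto intro!: mult_right_mono\<close>)
    qed
    with \<xi>o(1) show ?thesis by (rule landau_o.big_trans)
  qed
  ultimately have "(\<lambda>t. x t + \<xi>1 t) \<in> O[at_top](\<lambda>t. exp (- (\<mu> * t)))" by (rule sum_in_bigo)
  then show ?thesis by (simp add: x_def X_def)
qed

corollary sharp_decay_p:
  assumes mu: "0 < \<mu>" "\<mu> \<le> 2" "2 * \<mu> \<le> \<beta> + \<gamma>"
    and kappa: "2 * e * \<beta> - (\<mu> - 2) * (\<beta> + \<gamma> - 2 - \<mu>) > 0"
  shows "(\<lambda>t. p t - 1) \<in> O[at_top](\<lambda>t. exp (- (\<mu> * t)))"
proof -
  have ne: "1 + e \<noteq> 0" using e by linarith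
  have "(\<lambda>t. (1 + (P t - 1)) powr (1 / (1 + e)) - 1) \<in> O[at_top](\<lambda>t. P t - 1)"
    by (rule landau_o.big.compose[OF powr_expansion_1 decaying_tendsto_0[OF sharp_decay[OF assms] mu(1)]])
  then have "(\<lambda>t. (1 + (P t - 1)) powr (1 / (1 + e)) - 1) \<in> O[at_top](\<lambda>t. exp (- (\<mu> * t)))"
    using sharp_decay[OF assms] by (rule landau_o.big_trans)
  moreover have "(1 + (P t - 1)) powr (1 / (1 + e)) = p t" for t
    using p_pos[of t] ne by (simp add: P_def powr_powr)
  ultimately show ?thesis by (simp only:)
qed

end

section \<open>Asymptotics of the radial profile\<close>

text \<open>The constant \<open>C\<close> is chosen such that \<open>C r\<^sup>\<beta>\<close> balances the leading terms of the radial equation when \<open>f\<close> is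
replaced by its mean \<open>m\<close>.\<close>
lemma leading_coeff_power:
  assumes n: "n \<ge> 3" and k: "1 \<le> k" "k \<le> n" and m: "m > 0"
    and beta: "\<beta> = 2 * real k / (real k + 1)" and gamma: "\<gamma> = real n - \<beta>"
  shows "leading_coeff n k m > 0"
    and "\<gamma> * real (n choose k) * \<beta> ^ k * leading_coeff n k m ^ (k + 1) = real n * m"
proof -
  have beta0: "\<beta> > 0" and beta2: "\<beta> < 2" using k by (auto simp: beta field_simps)
  have gamma0: "\<gamma> > 0" using n beta2 by (simp add: gamma)
  have choose0: "real (n choose k) > 0" using k by simp
  define b where "b = real n * m / (real (n choose k) * \<gamma>)"
  have b: "b > 0" using n m choose0 gamma0 by (simp add: b_def)
  define K where "K = real k + 1"
  have K: "K > 0" by (simp add: K_def)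
  have C: "leading_coeff n k m = (1 / \<beta>) powr (real k / K) * b powr (1 / K)"
    unfolding leading_coeff_def b_def gamma beta K_def by simp
  show pos: "leading_coeff n k m > 0" using beta0 b by (simp add: C)
  have "leading_coeff n k m ^ (k + 1) = leading_coeff n k m powr K"
    using pos by (simp add: K_def powr_add powr_realpow)
  also have "\<dots> = (1 / \<beta>) powr (real k) * b"
    using beta0 b K by (simp add: C powr_mult powr_powr)
  also have "\<dots> = (1 / \<beta>) ^ k * b" using beta0 by (simp add: powr_realpow)
  finally show "\<gamma> * real (n choose k) * \<beta> ^ k * leading_coeff n k m ^ (k + 1) = real n * m"
    using beta0 gamma0 choose0 by (simp add: b_def power_divide)
qed

lemma radial_profile_system:
  fixes n k :: nat and f v :: "real \<Rightarrow> real" and T :: real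
  assumes n: "n \<ge> 3" and k: "1 \<le> k" "k \<le> n"
    and f: "continuous_on {0..} f" "\<forall>r\<ge>0. f r > 0"
    and T: "T > 0" and per: "\<forall>r\<ge>0. f (r + T) = f r"
    and prof: "radial_profile n k f v"
  defines "\<beta> \<equiv> 2 * real k / (real k + 1)"
  defines "C \<equiv> leading_coeff n k (period_mean T f)"
  shows "\<exists>q. profile_system k \<beta> (real n - \<beta>) T (\<lambda>r. f r / period_mean T f)
           (\<lambda>t. v (exp t) / (C * exp (\<beta> * t))) q"
proof -
  define N where "N = real n"
  define \<gamma> where "\<gamma> = real n - \<beta>"
  define m where "m = period_mean T f"
  define b where "b = real (n choose k)"
  have N: "N > 0" using n by (simp add: N_def)
  have b: "b > 0" using k by (simp add: b_def)
  have beta0: "\<beta> > 0" and beta2: "\<beta> < 2" using k by (auto simp: \<beta>_def field_simps)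
  have betaK: "\<beta> * (real k + 1) = 2 * real k" by (simp add: \<beta>_def)
  have gamma0: "\<gamma> > 0" using n beta2 by (simp add: \<gamma>_def)
  have "integral {0..T} f > 0" using integral_from_zero_pos[OF f(1) _ T] f(2) by auto
  then have m: "m > 0" and mT: "integral {0..T} f = m * T" using T by (simp_all add: m_def period_mean_def)
  have C0: "C > 0" and CK: "\<gamma> * b * \<beta> ^ k * C ^ (k + 1) = N * m"
    using leading_coeff_power[OF n k m \<beta>_def[unfolded atomize_eq] \<gamma>_def] by (simp_all add: C_def m_def b_def N_def)
  have v_pos: "v r > 0" if "r \<ge> 0" for r using prof that by (simp add: radial_profile_def)
  have v_cont: "continuous_on {0..} v"
    using prof unfolding radial_profile_def C2_on_def
    by (meson DERIV_continuous continuous_on_eq_continuous_within)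
  define h where "h s = s ^ (n - 1) * (f s / v s)" for s
  define I where "I r = integral {0..r} h" for r
  have h_cont: "continuous_on {0..} h" unfolding h_def
    using v_pos by (intro continuous_intros f v_cont) (metis atLeast_iff less_irrefl)
  have h_pos: "h s > 0" if "s > 0" for s using that f(2) v_pos[of s] by (simp add: h_def)
  have I_pos: "I r > 0" if "r > 0" for r
    unfolding I_def by (rule integral_from_zero_pos[OF h_cont h_pos that])
  have dI: "(I has_real_derivative h r) (at r)" if "r > 0" for r
    unfolding I_def by (rule integral_from_zero(2)[OF h_cont that])
  have dv: "(v has_real_derivative (N * r powr (real k - N) / b * I r) powr (1 / real k)) (at r)" if "r > 0" for r
    using prof that by (simp add: radial_profile_def I_def h_def[abs_def] N_def b_def)
  \<comment> \<open>The factor \<open>D\<close> is forced by the equation of \<open>p\<close>; that the same factor fits the equation of \<open>q\<close> is the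
    balance expressed by \<open>CK\<close>.\<close>
  define D where "D = N / (b * C ^ k * \<beta> ^ k)"
  define p where "p t = v (exp t) / (C * exp (\<beta> * t))" for t
  define q where "q t = D * exp ((\<beta> - N) * t) * I (exp t)" for t
  have D0: "D > 0" using N b C0 beta0 by (simp add: D_def)
  have p_pos: "p t > 0" for t using v_pos[of "exp t"] C0 by (simp add: p_def)
  have q_pos: "q t > 0" for t using I_pos[of "exp t"] D0 by (simp add: q_def)
  have v'_q: "(N * exp t powr (real k - N) / b * I (exp t)) powr (1 / real k)
      = \<beta> * C * exp ((\<beta> - 1) * t) * q t powr (1 / real k)" for t
  proof -
    define y where "y = \<beta> * C * exp ((\<beta> - 1) * t)"
    have y: "y > 0" using beta0 C0 by (simp add: y_def)
    have "exp ((\<beta> - 1) * t) ^ k * exp ((\<beta> - N) * t) = exp ((real k - N) * t)"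
    proof -
      have "real k * ((\<beta> - 1) * t) + (\<beta> - N) * t = (\<beta> * (real k + 1) - real k - N) * t" by (simp add: algebra_simps)
      then have "real k * ((\<beta> - 1) * t) + (\<beta> - N) * t = (real k - N) * t" by (simp add: betaK)
      then show ?thesis by (simp flip: exp_of_nat_mult exp_add)
    qed
    then have "y ^ k * q t = N * exp ((real k - N) * t) / b * I (exp t)"
      using beta0 C0 b by (simp add: y_def q_def D_def power_mult_distrib field_simps)
    moreover have "exp t powr (real k - N) = exp ((real k - N) * t)" by (simp add: powr_def)
    ultimately have "(N * exp t powr (real k - N) / b * I (exp t)) powr (1 / real k) = (y ^ k * q t) powr (1 / real k)"
      by simp
    also have "\<dots> = y * q t powr (1 / real k)"
      using y k by (simp add: powr_mult powr_powr flip: powr_realpow)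
    finally show ?thesis by (simp add: y_def)
  qed
  have dp: "(p has_real_derivative \<beta> * (q t powr (1 / real k) - p t)) (at t)" for t
  proof -
    have "((\<lambda>t. v (exp t)) has_real_derivative \<beta> * C * exp ((\<beta> - 1) * t) * q t powr (1 / real k) * exp t) (at t)"
      using DERIV_chain2[OF dv[of "exp t", unfolded v'_q] DERIV_exp] by simp
    moreover have "\<beta> * C * exp ((\<beta> - 1) * t) * q t powr (1 / real k) * exp t = \<beta> * C * exp (\<beta> * t) * q t powr (1 / real k)"
    proof -
      have "exp ((\<beta> - 1) * t) * exp t = exp (\<beta> * t)" by (simp add: algebra_simps flip: exp_add)
      then show ?thesis by (simp add: mult_ac)
    qed
    ultimately have "((\<lambda>t. v (exp t)) has_real_derivative \<beta> * C * exp (\<beta> * t) * q t powr (1 / real k)) (at t)" by simp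
    moreover have "((\<lambda>t. C * exp (\<beta> * t)) has_real_derivative C * (\<beta> * exp (\<beta> * t))) (at t)"
      by (auto intro!: derivative_eq_intros)
    ultimately have "(p has_real_derivative ((\<beta> * C * exp (\<beta> * t) * q t powr (1 / real k)) * (C * exp (\<beta> * t))
        - v (exp t) * (C * (\<beta> * exp (\<beta> * t)))) / ((C * exp (\<beta> * t)) * (C * exp (\<beta> * t)))) (at t)"
      unfolding p_def by (rule DERIV_divide) (use C0 in simp)
    moreover have "((\<beta> * C * E * s) * (C * E) - w * (C * (\<beta> * E))) / ((C * E) * (C * E)) = \<beta> * (s - w / (C * E))"
      if "E > 0" for E s w :: real using C0 that by (simp add: field_simps)
    note this[OF exp_gt_zero]
    ultimately show ?thesis by (simp only: p_def)
  qed
  have dq: "(q has_real_derivative \<gamma> * (f (exp t) / m / p t - q t)) (at t)" for t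
  proof -
    have "((\<lambda>t. I (exp t)) has_real_derivative h (exp t) * exp t) (at t)"
      using DERIV_chain2[OF dI[of "exp t"] DERIV_exp] by simp
    then have "(q has_real_derivative D * ((\<beta> - N) * exp ((\<beta> - N) * t)) * I (exp t)
        + D * exp ((\<beta> - N) * t) * (h (exp t) * exp t)) (at t)"
      unfolding q_def by (auto intro!: derivative_eq_intros)
    moreover have "D * ((\<beta> - N) * exp ((\<beta> - N) * t)) * I (exp t) = - \<gamma> * q t"
      by (simp add: q_def \<gamma>_def N_def algebra_simps)
    moreover have "D * exp ((\<beta> - N) * t) * (h (exp t) * exp t) = \<gamma> * (f (exp t) / m / p t)"
    proof -
      have 1: "exp t ^ (n - 1) * exp t = exp (N * t)"
      proof -
        have "exp t ^ (n - 1) * exp t = exp t ^ n" using n by (simp add: power_eq_if)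
        then show ?thesis by (simp add: N_def exp_of_nat_mult)
      qed
      have "exp ((\<beta> - N) * t) * (exp t ^ (n - 1) * exp t) = exp (\<beta> * t)"
        unfolding 1 by (simp add: algebra_simps flip: exp_add)
      then have "exp ((\<beta> - N) * t) * (h (exp t) * exp t) = exp (\<beta> * t) * (f (exp t) / v (exp t))"
        by (simp add: h_def mult_ac)
      moreover have "D = \<gamma> * C / m"
      proof -
        have "D * (b * C ^ k * \<beta> ^ k) = N" using b C0 beta0 by (simp add: D_def)
        then have "D * (b * C ^ k * \<beta> ^ k) * m = \<gamma> * C * (b * C ^ k * \<beta> ^ k)"
          using CK by (simp add: mult_ac)
        then have "(D * m) * (b * C ^ k * \<beta> ^ k) = \<gamma> * C * (b * C ^ k * \<beta> ^ k)" by (simp only: mult_ac)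
        moreover have "b * C ^ k * \<beta> ^ k \<noteq> 0" using b C0 beta0 by simp
        ultimately have "D * m = \<gamma> * C" using mult_right_cancel by blast
        then show ?thesis using m by (simp add: field_simps)
      qed
      ultimately show ?thesis using m C0 by (simp add: p_def mult_ac)
    qed
    ultimately have "(q has_real_derivative - \<gamma> * q t + \<gamma> * (f (exp t) / m / p t)) (at t)" by (simp only:)
    then show ?thesis by (simp add: right_diff_distrib)
  qed
  have "profile_system k \<beta> \<gamma> T (\<lambda>r. f r / m) p q"
  proof
    show "integral {0..T} (\<lambda>r. f r / m) = T" using mT m by (simp add: integral_divide)
    show "continuous_on {0..} (\<lambda>r. f r / m)" using f m by (auto intro!: continuous_intros)
    show "\<forall>r\<ge>0. 0 < f r / m" using f(2) m by simp
    show "\<forall>r\<ge>0. f (r + T) / m = f r / m" using per by simp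
    show "\<beta> = 2 * real k / (real k + 1)" by (simp add: \<beta>_def)
  qed (fact k T gamma0 p_pos q_pos dp dq)+
  then show ?thesis unfolding p_def \<gamma>_def m_def by blast
qed

text \<open>For \<open>n \<ge> 4\<close> the second entry of the minimum is \<open>2 - \<beta>\<close>. For \<open>n = 3\<close> the first entry is estimated with
\<open>Re (csqrt z) \<ge> 0\<close>, so that \<open>\<lambda>\<^sub>+\<close> has real part at least \<open>(k-3)/(4k)\<close>, whatever the sign of the discriminant.\<close>
lemma remainder_exponent_le:
  assumes n: "n \<ge> 3" and k: "1 \<le> k"
  shows "remainder_exponent n k \<le> (if n = 3 then 3 / 2 else 2) - 2 * real k / (real k + 1)"
proof (cases "n = 3")
  case True
  have "lambda_star n k \<ge> Re (lambda_plus n k)" by (simp add: lambda_star_def)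
  moreover have "Re (lambda_plus n k) \<ge> - ((real n - 4) * real k + real n) / (4 * real k)"
    using Re_csqrt[of "of_real (discriminant n k)"] by (simp add: lambda_plus_def)
  ultimately have "lambda_star n k \<ge> - (3 - real k) / (4 * real k)" using True by simp
  then have "4 * (real k * lambda_star n k) \<ge> real k - 3" using k by (simp add: field_simps)
  then have "0 \<le> (3 - real k + 4 * (real k * lambda_star n k)) / (2 * (real k + 1))" by simp
  also have "\<dots> = 3 / 2 - 2 * real k / (real k + 1) + 2 * real k * lambda_star n k / (real k + 1)"
  proof -
    have "(3 - (s - 1) + 4 * y) / (2 * s) = 3 / 2 - 2 * (s - 1) / s + 2 * y / s" if "s > 0" for s y :: real
      using that by (simp add: field_simps)
    from this[of "real k + 1" "real k * lambda_star n k"] show ?thesis by (simp add: mult.assoc)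
  qed
  finally have "- (2 * real k * lambda_star n k / (real k + 1)) \<le> 3 / 2 - 2 * real k / (real k + 1)"
    by linarith
  then show ?thesis using True by (simp add: remainder_exponent_def)
next
  case False
  have "2 / (real k + 1) = 2 - 2 * real k / (real k + 1)" by (simp add: field_simps)
  then show ?thesis using False by (simp add: remainder_exponent_def)
qed

theorem radial_profile_asymptotics:
  fixes n k :: nat and f v :: "real \<Rightarrow> real" and T :: real
  assumes n: "n \<ge> 3" and k: "1 \<le> k" "k \<le> n"
    and f: "continuous_on {0..} f" "\<forall>r\<ge>0. f r > 0"
    and T: "T > 0" and per: "\<forall>r\<ge>0. f (r + T) = f r"
    and prof: "radial_profile n k f v"
  shows "(\<lambda>r. v r - leading_coeff n k (period_mean T f) * r powr (2 * real k / (real k + 1)))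
    \<in> O[at_top](\<lambda>r. r powr (- remainder_exponent n k))"
proof -
  define \<beta> where "\<beta> = 2 * real k / (real k + 1)"
  define C where "C = leading_coeff n k (period_mean T f)"
  define p where "p t = v (exp t) / (C * exp (\<beta> * t))" for t
  \<comment> \<open>For \<open>n = 3\<close> the rate is limited by the condition \<open>2 \<mu> \<le> n\<close>, and \<open>k \<le> 3\<close> gives the positivity of \<open>\<kappa>\<close>.\<close>
  define \<mu> :: real where "\<mu> = (if n = 3 then 3 / 2 else 2)"
  have "2 * (1 / real k) * \<beta> = 4 / (real k + 1)" using k by (simp add: \<beta>_def)
  moreover have "4 / (real k + 1) \<ge> 1" if "n = 3" using that k by simp
  ultimately have kappa: "2 * (1 / real k) * \<beta> - (\<mu> - 2) * (\<beta> + (real n - \<beta>) - 2 - \<mu>) > 0"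
    by (auto simp: \<mu>_def)
  obtain q where "profile_system k \<beta> (real n - \<beta>) T (\<lambda>r. f r / period_mean T f) p q"
    using radial_profile_system[OF assms] unfolding p_def C_def \<beta>_def by blast
  then interpret profile_system k \<beta> "real n - \<beta>" T "\<lambda>r. f r / period_mean T f" p q .
  have conv: "(\<lambda>t. p t - 1) \<in> O[at_top](\<lambda>t. exp (- (\<mu> * t)))"
    using n kappa by (intro sharp_decay_p) (auto simp: \<mu>_def)
  have "(\<lambda>r. p (ln r) - 1) \<in> O[at_top](\<lambda>r. exp (- (\<mu> * ln r)))"
    by (rule landau_o.big.compose[OF conv ln_at_top])
  then have "(\<lambda>r. C * exp (\<beta> * ln r) * (p (ln r) - 1)) \<in> O[at_top](\<lambda>r. exp (\<beta> * ln r) * exp (- (\<mu> * ln r)))"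
    by (intro landau_o.big.mult) simp_all
  also have "(\<lambda>r. exp (\<beta> * ln r) * exp (- (\<mu> * ln r))) \<in> O[at_top](\<lambda>r::real. r powr (- remainder_exponent n k))"
  proof (rule bigoI[of _ 1])
    show "\<forall>\<^sub>F r::real in at_top. norm (exp (\<beta> * ln r) * exp (- (\<mu> * ln r))) \<le> 1 * norm (r powr (- remainder_exponent n k))"
      using eventually_ge_at_top[of 1]
    proof eventually_elim
      case (elim r)
      have "\<beta> - \<mu> \<le> - remainder_exponent n k"
        using remainder_exponent_le[OF n k(1)] by (simp add: \<mu>_def \<beta>_def)
      then have "r powr (\<beta> - \<mu>) \<le> r powr (- remainder_exponent n k)" using elim by (rule powr_mono)
      moreover have "exp (\<beta> * ln r) * exp (- (\<mu> * ln r)) = r powr (\<beta> - \<mu>)"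
        using elim by (simp add: powr_def algebra_simps flip: exp_add)
      ultimately show ?case by simp
    qed
  qed
  finally have main: "(\<lambda>r. C * exp (\<beta> * ln r) * (p (ln r) - 1)) \<in> O[at_top](\<lambda>r. r powr (- remainder_exponent n k))" .
  have C0: "C \<noteq> 0"
  proof
    assume "C = 0"
    then show False using p_pos[of 0] by (simp add: p_def)
  qed
  have "\<forall>\<^sub>F r in at_top. C * exp (\<beta> * ln r) * (p (ln r) - 1) = v r - C * r powr \<beta>"
    using eventually_gt_at_top[of 0]
    by eventually_elim (use C0 in \<open>simp add: p_def powr_def field_simps\<close>)
  then have "(\<lambda>r. v r - C * r powr \<beta>) \<in> O[at_top](\<lambda>r. r powr (- remainder_exponent n k))"
    using main by (rule landau_o.big.in_cong[THEN iffD1])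
  then show ?thesis by (simp only: C_def \<beta>_def)
qed

theorem corollary1p7:
  fixes n k :: nat and f g v :: "real \<Rightarrow> real" and Tf Tg :: real
    and u :: "real^'n::finite \<Rightarrow> real \<Rightarrow> real"
  assumes "CARD('n) = n" and "n \<ge> 3" and "1 \<le> k" and "k \<le> n"
    and "continuous_on {0..} f" and "\<forall>r\<ge>0. f r > 0"
    and "Tf > 0" and "\<forall>r\<ge>0. f (r + Tf) = f r"
    and "continuous_on {..0} g" and "\<forall>t\<le>0. g t > 0"
    and "Tg > 0" and "\<forall>t\<le>0. g (t - Tg) = g t"
    and "radial_profile n k f v"
    and "\<forall>x. \<forall>t\<le>0. u x t = time_factor k g t * v (norm x)"
    and "solves_hessian_equation k f g u"
  shows "\<exists>F1 F2. zero_mean_periodic Tf F1 \<and> zero_mean_periodic Tf F2 \<and>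
    (\<lambda>r. v r -
       (leading_coeff n k (period_mean Tf f) * r powr (2 * real k / (real k + 1))
        + r powr (- (2 / (real k + 1))) * F1 r
        + r powr (- ((real k + 3) / (real k + 1))) * F2 r))
    \<in> O[at_top](\<lambda>r. r powr (- remainder_exponent n k))"
proof (intro exI conjI)
  \<comment> \<open>As \<open>M \<le> 2/(k+1)\<close>, both oscillating terms are absorbed by the remainder.\<close>
  show "zero_mean_periodic Tf (\<lambda>_. 0)" by (simp add: zero_mean_periodic_def)
  then show "zero_mean_periodic Tf (\<lambda>_. 0)" .
  show "(\<lambda>r. v r -
       (leading_coeff n k (period_mean Tf f) * r powr (2 * real k / (real k + 1))
        + r powr (- (2 / (real k + 1))) * 0
        + r powr (- ((real k + 3) / (real k + 1))) * 0))
    \<in> O[at_top](\<lambda>r. r powr (- remainder_exponent n k))"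
    using radial_profile_asymptotics[of n k f Tf v] assms by simp
qed

end
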